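(* Let $(X_i)_{i\in\mathbb{N}}$ be a sequence of identically distributed real random variables on a probability space $(\Omega,\mathcal{F},\mathbb{P})$ with distribution function $F$, and let $\widehat F_n=\frac1n\sum_{i=1}^n \mathbf{1}_{[X_i,\infty)}$. Let $\phi$ be a weight function and suppose that $\int_{-\infty}^\infty\phi\,dF<\infty$. Suppose that $(X_i)$ is $\alpha$-mixing with mixing coefficients $(\alpha(n))$, let $\alpha(t):=\alpha(\lfloor t\rfloor)$, $t\in\mathbb{R}_+$, be the c\`adl\`ag extension of $\alpha(\cdot)$ to $\mathbb{R}_+$, and assume that $$\int_0^1\log\big(1+\alpha^{\rightarrow}(s/2)\big)\,\overline G^{\rightarrow}(s)\,ds<\infty,$$ where $\overline G:=1-G$ and $G$ denotes the distribution function of $\phi(X_1)$. Then $$\|\widehat F_n-F\|_\phi\longrightarrow0\qquad\mathbb{P}\text{-a.s. as } n\to\infty.$$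
   Context: A weight function is a continuous function $\phi:\mathbb{R}\to\mathbb{R}_+$ that is bounded away from zero (there is $\varepsilon>0$ with $\phi(x)\ge\varepsilon$ for all $x$) and u-shaped: there is $x_\phi\in\mathbb{R}$ such that $\phi$ is nonincreasing on $(-\infty,x_\phi]$ and nondecreasing on $[x_\phi,\infty)$. For $\psi:\mathbb{R}\to\mathbb{R}$, $\|\psi\|_\phi:=\sup_{x\in\mathbb{R}}|\psi(x)|\phi(x)$. The mixing coefficients are $\alpha(n):=\sup_{k\ge1}\sup_{A,B}|\mathbb{P}[A\cap B]-\mathbb{P}[A]\mathbb{P}[B]|$, where the second supremum ranges over all $A\in\sigma(X_1,\dots,X_k)$ and $B\in\sigma(X_{k+n},X_{k+n+1},\dots)$; the value $\alpha(0)$ is given by the same formula with $n=0$. The sequence is $\alpha$-mixing if $\alpha(n)\to0$ as $n\to\infty$. For a nonincreasing function $h:\mathbb{R}_+\to[0,1]$, its right-continuous inverse is $h^{\rightarrow}(y):=\sup\{x\in\mathbb{R}_+: h(x)>y\}$, $y\in[0,1]$, with the convention $\sup\emptyset:=0$. *)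

theory Defs
  imports "HOL-Probability.Probability"
begin

definition weight_function :: "(real \<Rightarrow> real) \<Rightarrow> bool" where
  "weight_function \<phi> \<longleftrightarrow>
     continuous_on UNIV \<phi> \<and>
     (\<exists>\<epsilon>>0. \<forall>x. \<phi> x \<ge> \<epsilon>) \<and>
     (\<exists>x\<^sub>0. antimono_on {..x\<^sub>0} \<phi> \<and> mono_on {x\<^sub>0..} \<phi>)"

(* Valued in ennreal because the supremum may be infinite. *)
definition weighted_norm :: "(real \<Rightarrow> real) \<Rightarrow> (real \<Rightarrow> real) \<Rightarrow> ennreal" where
  "weighted_norm \<phi> \<psi> = (SUP x. ennreal (\<bar>\<psi> x\<bar> * \<phi> x))"

(* Sequences of random variables are indexed from 1 throughout; X 0 is never used. *)
definition empirical_cdf :: "(nat \<Rightarrow> 'a \<Rightarrow> real) \<Rightarrow> nat \<Rightarrow> 'a \<Rightarrow> real \<Rightarrow> real" where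
  "empirical_cdf X n \<omega> x = (1 / real n) * (\<Sum>i=1..n. indicator {X i \<omega>..} x)"

(* The sigma-algebra on space M generated by the variables X i, i in I. *)
definition sigma_rv :: "'a measure \<Rightarrow> (nat \<Rightarrow> 'a \<Rightarrow> real) \<Rightarrow> nat set \<Rightarrow> 'a set set" where
  "sigma_rv M X I =
     sigma_sets (space M) (\<Union>i\<in>I. {X i -` S \<inter> space M | S. S \<in> sets borel})"

(* Real suprema suffice: for a probability space M all the values lie in [0,1]. *)
definition alpha_coeff :: "'a measure \<Rightarrow> (nat \<Rightarrow> 'a \<Rightarrow> real) \<Rightarrow> nat \<Rightarrow> real" where
  "alpha_coeff M X n =
     (SUP k\<in>{1..}. SUP (A, B)\<in>sigma_rv M X {1..k} \<times> sigma_rv M X {k + n..}.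
        \<bar>measure M (A \<inter> B) - measure M A * measure M B\<bar>)"

definition alpha_mixing :: "'a measure \<Rightarrow> (nat \<Rightarrow> 'a \<Rightarrow> real) \<Rightarrow> bool" where
  "alpha_mixing M X \<longleftrightarrow> alpha_coeff M X \<longlonglongrightarrow> 0"

(* Extension of a sequence to [0,\<infinity>) by the integer part; only used at t \<ge> 0. *)
definition cadlag_ext :: "(nat \<Rightarrow> real) \<Rightarrow> real \<Rightarrow> real" where
  "cadlag_ext a t = a (nat \<lfloor>t\<rfloor>)"

(* The supremum is taken in ennreal: it may be infinite (typically at y = 0),
   and the supremum of the empty set is 0, as required by the usual convention. *)
definition right_inverse :: "(real \<Rightarrow> real) \<Rightarrow> real \<Rightarrow> ennreal" where
  "right_inverse h y = (SUP x\<in>{x. 0 \<le> x \<and> h x > y}. ennreal x)"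

(* u \<mapsto> log (1 + u) on [0,\<infinity>], with value \<infinity> at \<infinity>. *)
definition ennreal_log1p :: "ennreal \<Rightarrow> ennreal" where
  "ennreal_log1p u = (if u = \<infinity> then \<infinity> else ennreal (ln (1 + enn2real u)))"

end

theory Submission
  imports Defs
begin

text \<open>
Monotonicity of the weight on both sides of its minimum reduces the theorem to a strong law of large
numbers for the sequences \<open>f (X i)\<close> with \<open>0 \<le> f \<le> \<phi>\<close> (\<open>strong_law_weighted\<close>). Far out, for instance to
the right, \<open>\<phi> x\<close> times the indicator of \<open>{x<..}\<close> is at most \<open>\<phi>\<close> restricted to the tail; hence the weighted error
there is at most an empirical average of that restriction plus its mean, and both are small by
the strong law and integrability (\<open>weighted_tail_bound\<close>). On a bounded interval the weight is bounded, and the strong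
law for indicator functions gives the classical theorem of Glivenko and Cantelli.

The strong law is an identically distributed version of a theorem of Rio, for sequences that need not be
stationary. Write \<open>K\<close> for a quantile function that dominates the variables and \<open>N s\<close> for the first lag at
which the mixing coefficient is at most \<open>s\<close>; the hypothesis says that \<open>K * (1 + ln N)\<close> is integrable over the unit interval.
At sample size \<open>n\<close> the levels \<open>s\<close> are split according to whether \<open>N s * K s\<close> exceeds \<open>n\<close>
(\<open>scale_choice\<close>). The threshold determines a truncation level \<open>v\<close> and a block length \<open>q\<close> with \<open>q * v \<le> n\<close>. What
truncation removes is estimated by first moments. For the truncated variables second moments would be too crude,
since mixing coefficients that decrease slowly beyond the lag \<open>q\<close> would be multiplied by \<open>v\<^sup>2\<close> at every lag. Instead, the
expectation of a Huber function of the partial sums is followed through time. Its derivative is bounded by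
\<open>n\<close>, which makes one application of mixing at lag \<open>q\<close> sufficient, and it is 1-Lipschitz, which reduces the lags below
\<open>q\<close> to covariances of two single variables (\<open>drift_bound\<close>, \<open>covariance_lag\<close>). This takes the place of
coupling with independent blocks.

The resulting bound on the deviation probability (\<open>deviation_bound\<close>) is an integral over levels. For
fixed \<open>s\<close> the integrand is of order \<open>K s\<close> for the sizes \<open>n\<close> between \<open>K s\<close> and \<open>N s * K s\<close> and geometrically small
elsewhere, so its sum over dyadic \<open>n\<close> is at most a multiple of \<open>K s * (1 + ln (N s))\<close> (\<open>sum_scale_weight_le\<close>). Borel-Cantelli and
monotonicity of the partial sums finish the proof of the strong law.
\<close>

section \<open>The Huber function, dyadic sums and the choice of scale\<close>

definition clip :: "real \<Rightarrow> real \<Rightarrow> real" where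
  "clip n x = max (- n) (min n x)"

text \<open>The Huber function: \<open>x\<^sup>2 / 2\<close> on \<open>[-n, n]\<close>, continued linearly with slope \<open>n\<close>, so that \<open>clip n\<close> is
its derivative. It sees variances at the scale below \<open>n\<close>, but a failure of near-independence
costs it only its slope \<open>n\<close> and not the square of the partial sum.\<close>

definition huber :: "real \<Rightarrow> real \<Rightarrow> real" where
  "huber n x = clip n x * x - (clip n x)\<^sup>2 / 2"

lemma clip_bound: "0 \<le> n \<Longrightarrow> \<bar>clip n x\<bar> \<le> n"
  by (auto simp: clip_def)

lemma clip_lipschitz: "\<bar>clip n x - clip n y\<bar> \<le> \<bar>x - y\<bar>"
  by (auto simp: clip_def max_def min_def)

lemma clip_0 [simp]: "0 \<le> n \<Longrightarrow> clip n 0 = 0"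
  by (auto simp: clip_def)

lemma clip_measurable [measurable]: "clip n \<in> borel_measurable borel"
  unfolding clip_def by measurable

lemma huber_measurable [measurable]: "huber n \<in> borel_measurable borel"
  unfolding huber_def by measurable

lemma huber_0 [simp]: "0 \<le> n \<Longrightarrow> huber n 0 = 0"
  by (simp add: huber_def)

text \<open>Taylor expansion: the derivative \<open>clip n\<close> is 1-Lipschitz.\<close>

lemma huber_step:
  assumes "0 \<le> n"
  shows "huber n (x + d) \<le> huber n x + clip n x * d + d\<^sup>2 / 2"
proof -
  define t r where "t = clip n (x + d)" and "r = clip n x"
  have id: "huber n x + clip n x * d + d\<^sup>2 / 2 - huber n (x + d)
      = (d\<^sup>2 - (t - r)\<^sup>2) / 2 - (t - r) * (x + d - t)"
    unfolding huber_def t_def[symmetric] r_def[symmetric] by (simp add: field_simps power2_eq_square)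
  have "(t - r)\<^sup>2 + 2 * ((t - r) * (x + d - t)) \<le> d\<^sup>2"
  proof (cases "(t - r) * (x + d - t) \<le> 0")
    case True
    have "(t - r)\<^sup>2 \<le> d\<^sup>2"
      using clip_lipschitz[of n "x + d" x] by (intro abs_le_square_iff[THEN iffD1]) (simp add: t_def r_def)
    then show ?thesis using True by simp
  next
    case False
    then have "\<bar>(t - r) + (x + d - t)\<bar> \<le> \<bar>d\<bar>"
      using assms unfolding t_def r_def clip_def max_def min_def
      by (auto simp: zero_less_mult_iff not_le split: if_splits)
    then have "((t - r) + (x + d - t))\<^sup>2 \<le> d\<^sup>2"
      by (rule abs_le_square_iff[THEN iffD1])
    moreover have "((t - r) + (x + d - t))\<^sup>2
        = (t - r)\<^sup>2 + 2 * ((t - r) * (x + d - t)) + (x + d - t)\<^sup>2"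
      by (simp add: power2_eq_square algebra_simps)
    ultimately show ?thesis by (smt (verit) zero_le_power2)
  qed
  then show ?thesis using id by (simp add: field_simps)
qed

text \<open>By its definition as \<open>t x - t\<^sup>2 / 2\<close> at \<open>t = clip n x\<close>, the Huber function is the maximum of this
expression over \<open>-n \<le> t \<le> n\<close>; the bound is the value at \<open>t = \<delta>\<close> or \<open>t = -\<delta>\<close>. It turns bounds on the
expected Huber function into bounds on deviation probabilities.\<close>

lemma huber_ge:
  assumes "0 \<le> \<delta>" "\<delta> \<le> n" "\<delta> \<le> \<bar>x\<bar>"
  shows "\<delta>\<^sup>2 / 2 \<le> huber n x"
proof -
  have "\<delta> * \<bar>x\<bar> - \<delta>\<^sup>2 / 2 \<le> huber n x"
  proof -
    define t where "t = \<bar>clip n x\<bar>"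
    have t: "huber n x = t * \<bar>x\<bar> - t\<^sup>2 / 2"
      using assms by (auto simp: huber_def t_def clip_def max_def min_def abs_if)
    have "0 \<le> (t - \<delta>) * (2 * \<bar>x\<bar> - (t + \<delta>))"
      using assms unfolding t_def clip_def max_def min_def
      by (intro mult_nonneg_nonneg) (auto split: if_splits)
    then show ?thesis unfolding t by (simp add: power2_eq_square algebra_simps)
  qed
  moreover have "\<delta> * \<delta> \<le> \<delta> * \<bar>x\<bar>" using assms by (intro mult_left_mono) auto
  ultimately show ?thesis by (simp add: power2_eq_square)
qed

lemma huber_nonneg: "0 \<le> n \<Longrightarrow> 0 \<le> huber n x"
  using huber_ge[of 0 n x] by simp

lemma huber_upper: "0 \<le> n \<Longrightarrow> huber n x \<le> n * \<bar>x\<bar>"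
proof -
  assume "0 \<le> n"
  have "clip n x * x \<le> \<bar>clip n x\<bar> * \<bar>x\<bar>" by (metis abs_ge_self abs_mult)
  also have "\<dots> \<le> n * \<bar>x\<bar>" using clip_bound[OF \<open>0 \<le> n\<close>, of x] by (intro mult_right_mono) auto
  finally have "clip n x * x \<le> n * \<bar>x\<bar>" .
  moreover have "0 \<le> (clip n x)\<^sup>2" by simp
  ultimately show ?thesis unfolding huber_def by linarith
qed

text \<open>The contribution of one quantile level to the probability of a large deviation at sample size \<open>x\<close>.
Here \<open>K\<close> is the quantile of the variables at that level and \<open>N\<close> the lag at which the mixing
coefficient has fallen to the level. Levels with \<open>N * K > x\<close> are removed by truncation and
contribute their first moment, capped at \<open>x\<close>; the others contribute to the variance of an average,
of order \<open>N * K\<^sup>2 / x\<close>.\<close>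

definition scale_weight :: "real \<Rightarrow> real \<Rightarrow> real \<Rightarrow> real" where
  "scale_weight K N x = (if N * K > x then min K x else N * K * K / x)"

lemma scale_weight_nonneg: "0 \<le> K \<Longrightarrow> 0 \<le> N \<Longrightarrow> 0 \<le> x \<Longrightarrow> 0 \<le> scale_weight K N x"
  by (auto simp: scale_weight_def)

text \<open>This is where the logarithm in the hypothesis comes from. Along \<open>x, 2 x, 4 x, ...\<close> the weights form
a geometric series below \<open>K\<close> and another one above \<open>N * K\<close>, each with sum at most of order \<open>K\<close>; between the
two thresholds every weight equals \<open>K\<close>, and there are about \<open>log 2 N\<close> of them.\<close>

lemma sum_scale_weight_le:
  fixes K N x :: real
  assumes K: "0 < K" and N: "1 \<le> N" and x: "0 < x"
  shows "(\<Sum>j<J. scale_weight K N (x * 2 ^ j)) \<le> 5 * K + K * log 2 N"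
proof -
  \<comment> \<open>A bound on the remaining sum as a function of the current point, so that the sum can be treated by induction.\<close>
  define \<Phi> where "\<Phi> x = (if x \<ge> N * K then 2 * N * K * K / x
    else if x \<ge> K then 3 * K + K * log 2 (N * K / x) else 5 * K + K * log 2 N - x)" for x
  have NK: "K \<le> N * K" using N K by simp
  have step: "scale_weight K N x + \<Phi> (2 * x) \<le> \<Phi> x" if x: "0 < x" for x
  proof -
    consider "x \<ge> N * K" | "x < N * K" "x \<ge> K" "2 * x \<ge> N * K" | "x \<ge> K" "2 * x < N * K"
      | "2 * x < K" | "x < K" "K \<le> 2 * x" by linarith
    then show ?thesis
    proof cases
      case 1
      then show ?thesis using x by (auto simp: scale_weight_def \<Phi>_def field_simps)
    next
      case 2
      have "0 \<le> log 2 (N * K / x)" using 2 x by simp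
      then have l: "0 \<le> K * log 2 (N * K / x)" using K by simp
      have "N * K * K \<le> 2 * x * K" using 2 K by (intro mult_right_mono) auto
      then have "2 * N * K * K / (2 * x) \<le> 2 * K" using x by (simp add: field_simps)
      moreover have "scale_weight K N x = K" "\<Phi> x = 3 * K + K * log 2 (N * K / x)"
        "\<Phi> (2 * x) = 2 * N * K * K / (2 * x)"
        using 2 by (auto simp: scale_weight_def \<Phi>_def)
      ultimately show ?thesis using l by linarith
    next
      case 3
      have "log 2 (N * K / (2 * x)) = log 2 (N * K / x) - 1"
        using x K N by (simp add: log_divide log_mult)
      then have "K * log 2 (N * K / (2 * x)) = K * log 2 (N * K / x) - K"
        by (simp only: right_diff_distrib)
      moreover have "scale_weight K N x = K" "\<Phi> x = 3 * K + K * log 2 (N * K / x)"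
        "\<Phi> (2 * x) = 3 * K + K * log 2 (N * K / (2 * x))"
        using 3 x by (auto simp: scale_weight_def \<Phi>_def)
      ultimately show ?thesis by linarith
    next
      case 4
      then have "\<not> N * K \<le> x" "\<not> N * K \<le> 2 * x" "\<not> K \<le> x" "\<not> K \<le> 2 * x" using NK x by linarith+
      then show ?thesis by (simp add: scale_weight_def \<Phi>_def)
    next
      case 5
      then have f: "x < N * K" "\<not> N * K \<le> x" "\<not> K \<le> x" using NK by linarith+
      then have s: "scale_weight K N x = x" by (simp add: scale_weight_def)
      have s': "\<Phi> x = 5 * K + K * log 2 N - x" using f by (simp add: \<Phi>_def)
      have ln: "0 \<le> K * log 2 N" using K N by simp
      have "\<Phi> (2 * x) \<le> 3 * K + K * log 2 N"
      proof (cases "2 * x \<ge> N * K")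
        case True
        have "N * K * K \<le> 2 * x * K" using True K by (intro mult_right_mono) auto
        then have "2 * N * K * K / (2 * x) \<le> 2 * K" using x by (simp add: field_simps)
        moreover have "\<Phi> (2 * x) = 2 * N * K * K / (2 * x)" using True by (simp add: \<Phi>_def)
        ultimately show ?thesis using ln K by linarith
      next
        case False
        have "N * K / (2 * x) \<le> N" using 5 x N by (simp add: field_simps)
        then have "log 2 (N * K / (2 * x)) \<le> log 2 N" using x K N by simp
        then have "K * log 2 (N * K / (2 * x)) \<le> K * log 2 N" using K by (intro mult_left_mono) auto
        moreover have "\<Phi> (2 * x) = 3 * K + K * log 2 (N * K / (2 * x))"
          using False 5 by (simp add: \<Phi>_def)
        ultimately show ?thesis by linarith
      qed
      then show ?thesis using s s' 5 by linarith
    qed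
  qed
  have nonneg: "0 \<le> \<Phi> x" if "0 < x" for x
  proof -
    have "0 \<le> K * log 2 (N * K / x)" if "\<not> x \<ge> N * K" using that K \<open>0 < x\<close> by simp
    moreover have "0 \<le> K * log 2 N" using K N by simp
    ultimately show ?thesis using K N that unfolding \<Phi>_def by (smt (verit) divide_nonneg_pos mult_nonneg_nonneg)
  qed
  have main: "0 < x \<Longrightarrow> (\<Sum>j<J. scale_weight K N (x * 2 ^ j)) \<le> \<Phi> x" for x
  proof (induction J arbitrary: x)
    case 0
    then show ?case using nonneg by simp
  next
    case (Suc J)
    have "(\<Sum>j<Suc J. scale_weight K N (x * 2 ^ j))
        = scale_weight K N x + (\<Sum>j<J. scale_weight K N (2 * x * 2 ^ j))"
      by (simp only: sum.lessThan_Suc_shift) (simp add: mult_ac)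
    also have "\<dots> \<le> scale_weight K N x + \<Phi> (2 * x)" using Suc.IH[of "2 * x"] Suc.prems by simp
    also have "\<dots> \<le> \<Phi> x" by (rule step[OF Suc.prems])
    finally show ?case .
  qed
  have "\<Phi> x \<le> 5 * K + K * log 2 N"
  proof -
    have ln: "0 \<le> K * log 2 N" using K N by simp
    have "2 * N * K * K / x \<le> 2 * K" if "x \<ge> N * K"
    proof -
      have "N * K * K \<le> x * K" using that K by (intro mult_right_mono) auto
      then show ?thesis using x by (simp add: field_simps)
    qed
    moreover have "K * log 2 (N * K / x) \<le> K * log 2 N" if "x \<ge> K"
      using that x K N by (auto intro!: mult_left_mono simp: field_simps)
    ultimately show ?thesis using ln x K unfolding \<Phi>_def by (smt (verit))
  qed
  then show ?thesis using main[OF x] by linarith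
qed

text \<open>Both \<open>K\<close> and \<open>N\<close> decrease, so the levels \<open>s\<close> with \<open>N s * K s > n\<close> lie to the left of some
threshold \<open>s0\<close>. The truncation level \<open>v\<close> and the block length \<open>q\<close> are the one-sided limits of \<open>K\<close> and \<open>N\<close> from the
right at \<open>s0\<close>. Neither function is assumed to be one-sided continuous; hence suprema are taken over
the levels strictly above \<open>s0\<close>, and nothing is claimed at \<open>s0\<close> itself.\<close>

lemma scale_choice:
  fixes K :: "real \<Rightarrow> real" and N :: "real \<Rightarrow> nat" and a :: "nat \<Rightarrow> real" and n \<kappa> :: real
  assumes K: "antimono_on {0<..<1} K" and \<kappa>: "0 < \<kappa>" "\<And>s. s \<in> {0<..<1} \<Longrightarrow> \<kappa> \<le> K s"
    and N: "antimono_on {0<..<1} N" "\<And>s. s \<in> {0<..<1} \<Longrightarrow> 1 \<le> N s"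
    and a: "antimono a" "\<And>s. s \<in> {0<..<1} \<Longrightarrow> a (N s) \<le> s" "\<And>k. a k \<le> 1"
    and n: "0 < n"
  obtains s0 v :: real and q :: nat
  where "0 \<le> s0" "s0 \<le> 1" "0 \<le> v" "1 \<le> q" "q * v \<le> n" "a q \<le> s0"
    "\<And>s. s \<in> {0<..<1} \<Longrightarrow> s < s0 \<Longrightarrow> n < N s * K s \<and> v \<le> K s"
    "\<And>s. s \<in> {0<..<1} \<Longrightarrow> s0 < s \<Longrightarrow> N s * K s \<le> n \<and> K s \<le> v \<and> N s \<le> q"
proof -
  define B where "B = insert 0 {s \<in> {0<..<1}. n < N s * K s}"
  define s0 where "s0 = Sup B"
  have bdd: "bdd_above B" by (auto simp: B_def intro!: bdd_aboveI[of _ 1])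
  have s00: "0 \<le> s0" unfolding s0_def by (rule cSup_upper[OF _ bdd]) (simp add: B_def)
  have s01: "s0 \<le> 1" unfolding s0_def by (rule cSup_least) (auto simp: B_def)
  have above: "N s * K s \<le> n" if "s \<in> {0<..<1}" "s0 < s" for s
    using that cSup_upper[OF _ bdd, of s] by (fastforce simp: B_def s0_def)
  have below: "n < N s * K s" if that': "s \<in> {0<..<1}" "s < s0" for s
  proof -
    obtain t where t: "t \<in> B" "s < t" 
      using less_cSupE[of s B thesis] that that' unfolding s0_def by (auto simp: B_def)
    then have t': "t \<in> {0<..<1}" "n < N t * K t" using that' by (auto simp: B_def)
    have "real (N t) * K t \<le> N s * K s"
      using monotone_onD[OF N(1), of s t] monotone_onD[OF K, of s t] that' t t' \<kappa>(1) \<kappa>(2)[of t]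
      by (intro mult_mono) auto
    then show ?thesis using t' by linarith
  qed
  show ?thesis
  proof (cases "s0 = 1")
    case True
    \<comment> \<open>Every level is truncated away, so the truncation level can be zero.\<close>
    have "0 \<le> K s" if "s \<in> {0<..<1}" for s using \<kappa>(1) \<kappa>(2)[OF that] by linarith
    then show ?thesis
      using True n a(3)[of 1] below by (intro that[of s0 0 1]) auto
  next
    case False
    define T where "T = {s0<..<1}"
    have T: "T \<noteq> {}" "T \<subseteq> {0<..<1}" using False s00 s01 by (auto simp: T_def)
    have Tab: "N s * K s \<le> n" if "s \<in> T" for s using above[of s] that T by (auto simp: T_def)
    have Kn: "K s \<le> n" if "s \<in> T" for s
    proof -
      have "1 * K s \<le> N s * K s" using N(2)[of s] \<kappa>(1) \<kappa>(2)[of s] that T(2) by (intro mult_right_mono) auto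
      then show ?thesis using Tab[OF that] by simp
    qed
    \<comment> \<open>The positive lower bound of K keeps N bounded above s0, so that the integer q is attained as a maximum.\<close>
    have Nfin: "N s \<le> nat \<lfloor>n / \<kappa>\<rfloor>" if "s \<in> T" for s
    proof -
      have "N s * \<kappa> \<le> N s * K s" using \<kappa>(2)[of s] that T(2) by (intro mult_left_mono) auto
      then have "N s * \<kappa> \<le> n" using Tab[OF that] by simp
      then have "N s \<le> n / \<kappa>" using \<kappa>(1) by (simp add: field_simps)
      then show ?thesis by linarith
    qed
    have fin: "finite (N ` T)" by (rule finite_subset[of _ "{..nat \<lfloor>n / \<kappa>\<rfloor>}"]) (use Nfin in auto)
    define q where "q = Max (N ` T)"
    have "q \<in> N ` T" unfolding q_def using fin T by (intro Max_in) auto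
    then obtain s1 where s1: "s1 \<in> T" "q = N s1" by auto
    have Nq: "N s \<le> q" if "s \<in> T" for s unfolding q_def using fin that by auto
    define v where "v = Sup (K ` T)"
    have bddK: "bdd_above (K ` T)" using Kn by (auto intro!: bdd_aboveI[of _ n])
    have Kv: "K s \<le> v" if "s \<in> T" for s unfolding v_def by (rule cSup_upper[OF _ bddK]) (use that in auto)
    have q1: "1 \<le> q" using s1 N(2) T by auto
    have "v \<le> n / q"
      unfolding v_def
    proof (rule cSup_least)
      show "K ` T \<noteq> {}" using T by simp
      fix y assume "y \<in> K ` T"
      then obtain s where s: "s \<in> T" "y = K s" by auto
      have I: "s \<in> {0<..<1}" "s1 \<in> {0<..<1}" using s(1) s1(1) T(2) by blast+
      show "y \<le> n / q"
      proof (cases "s \<le> s1")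
        case True
        then have "N s = q"
          using monotone_onD[OF N(1), of s s1] Nq[OF s(1)] I s1(2) True by (intro order_antisym) auto
        then show ?thesis using Tab[OF s(1)] q1 s by (simp add: field_simps)
      next
        case False
        then have "K s \<le> K s1" using monotone_onD[OF K, of s1 s] I False by auto
        moreover have "K s1 \<le> n / q" using Tab[OF s1(1)] q1 s1 by (simp add: field_simps)
        ultimately show ?thesis using s by simp
      qed
    qed
    then have qv: "q * v \<le> n" using q1 by (simp add: field_simps)
    have v0: "0 \<le> v" using Kv[OF s1(1)] \<kappa>(1) \<kappa>(2)[of s1] s1 T(2) by force
    have aq: "a q \<le> s0"
    proof (rule ccontr)
      assume *: "\<not> a q \<le> s0"
      define s where "s = (s0 + a q) / 2"
      have s: "s \<in> T" "s < a q" using * a(3)[of q] by (auto simp: T_def s_def)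
      have "a q \<le> a (N s)" using Nq[OF s(1)] a(1) by (simp add: antimonoD)
      also have "\<dots> \<le> s" using a(2) s T by auto
      finally show False using s by simp
    qed
    have vK: "v \<le> K s" if "s \<in> {0<..<1}" "s < s0" for s
      unfolding v_def
      by (rule cSup_least) (use T that monotone_onD[OF K] in \<open>auto simp: T_def\<close>)
    show ?thesis
      by (rule that[of s0 v q]) (use s00 s01 v0 q1 qv aq below vK above Kv Nq in \<open>auto simp: T_def\<close>)
  qed
qed

text \<open>Monotonicity squeezes \<open>T n\<close> between its values at \<open>k * 2 ^ j\<close> and \<open>(k + 1) * 2 ^ j\<close>, and these two points
differ by a factor \<open>1 + 1 / k\<close>, which is close to one when \<open>k\<close> is large. Using several multipliers
\<open>k\<close> with powers of two replaces the usual subsequence \<open>\<lfloor>c ^ j\<rfloor>\<close> with \<open>c\<close> close to one.\<close>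

lemma averages_tendsto_from_dyadic:
  fixes T :: "nat \<Rightarrow> real"
  assumes mono: "mono T" and T0: "0 \<le> T 0" and \<mu>: "0 \<le> \<mu>"
    and lim: "\<And>k. 1 \<le> k \<Longrightarrow> (\<lambda>j. T (k * 2 ^ j) / (k * 2 ^ j)) \<longlonglongrightarrow> \<mu>"
  shows "(\<lambda>n. T n / n) \<longlonglongrightarrow> \<mu>"
proof (rule LIMSEQ_I)
  fix e :: real assume e: "0 < e"
  obtain m :: nat where m: "3 * (\<mu> + 1) / e < m" using reals_Archimedean2 by blast
  have m0: "0 < m"
  proof (rule ccontr)
    assume "\<not> 0 < m"
    then have "3 * (\<mu> + 1) / e < 0" using m by simp
    moreover have "0 < 3 * (\<mu> + 1) / e" using \<mu> e by simp
    ultimately show False by linarith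
  qed
  define \<delta> where "\<delta> = min 1 (e / 3)"
  have \<delta>: "0 < \<delta>" "\<delta> \<le> 1" "\<delta> \<le> e / 3" using e by (auto simp: \<delta>_def)
  have "\<forall>\<^sub>F j in sequentially. \<forall>k\<in>{m..2*m}. \<bar>T (k * 2 ^ j) / (k * 2 ^ j) - \<mu>\<bar> < \<delta>"
  proof (rule eventually_ball_finite)
    show "\<forall>k\<in>{m..2 * m}. \<forall>\<^sub>F j in sequentially. \<bar>T (k * 2 ^ j) / (k * 2 ^ j) - \<mu>\<bar> < \<delta>"
    proof
      fix k assume "k \<in> {m..2*m}"
      then have "1 \<le> k" using m0 by auto
      from tendstoD[OF lim[OF this] \<delta>(1)]
      show "\<forall>\<^sub>F j in sequentially. \<bar>T (k * 2 ^ j) / (k * 2 ^ j) - \<mu>\<bar> < \<delta>"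
        by (simp add: dist_real_def)
    qed
  qed simp
  then obtain J where J: "\<And>j k. j \<ge> J \<Longrightarrow> k \<in> {m..2*m} \<Longrightarrow> \<bar>T (k * 2 ^ j) / (k * 2 ^ j) - \<mu>\<bar> < \<delta>"
    unfolding eventually_sequentially by blast
  show "\<exists>n0. \<forall>n\<ge>n0. norm (T n / n - \<mu>) < e"
  proof (intro exI allI impI)
    fix n assume n: "n \<ge> m * 2 ^ J"
    \<comment> \<open>The largest j with m * 2 ^ j at most n; the leading digits k of n then lie between m and 2 * m.\<close>
    define P where "P j \<longleftrightarrow> m * 2 ^ j \<le> n" for j
    have ex: "P J" using n by (simp add: P_def)
    have bd: "P j \<Longrightarrow> j \<le> n" for j
    proof -
      assume "P j"
      then have "2 ^ j \<le> n" using m0 unfolding P_def by (metis Suc_leI mult_le_mono1 nat_mult_1 One_nat_def order_trans)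
      then show "j \<le> n" using less_exp[of j] by linarith
    qed
    define j where "j = (GREATEST j. P j)"
    have Pj: "P j" unfolding j_def by (rule GreatestI_nat[where P = P and k = J and b = n]) (use ex bd in blast)+
    have Jj: "J \<le> j" unfolding j_def by (rule Greatest_le_nat[where P = P and b = n]) (use ex bd in blast)+
    have nPj: "\<not> P (Suc j)" 
    proof
      assume "P (Suc j)"
      then have "Suc j \<le> j" unfolding j_def by (rule Greatest_le_nat[where P = P and b = n]) (use bd in blast)
      then show False by simp
    qed
    define k where "k = n div 2 ^ j"
    have k1: "m \<le> k" using Pj unfolding P_def k_def by (simp add: less_eq_div_iff_mult_less_eq)
    have k2: "k < 2 * m" using nPj unfolding P_def k_def
      by (simp add: div_less_iff_less_mult mult_ac)
    have nk: "k * 2 ^ j \<le> n" "n < (k + 1) * 2 ^ j"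
      unfolding k_def by (auto simp: dividend_less_div_times)
    have n0: "0 < real n" using nk k1 m0 by (cases "n = 0") auto
    have kpos: "0 < real k" using k1 m0 by simp
    have inv: "1 / real k \<le> 1 / m" using k1 m0 by (simp add: field_simps)
    have minv: "(\<mu> + 1) * (1 / m) < e / 3" using m m0 e by (simp add: field_simps)
    define p where "p = (2::real) ^ j"
    have p: "0 < p" by (simp add: p_def)
    have nkr: "k * p \<le> n" "n \<le> (k + 1) * p"
      using nk(1)[THEN of_nat_mono[where 'a = real]] nk(2)[THEN less_imp_le, THEN of_nat_mono[where 'a = real]]
      unfolding p_def by (simp_all add: algebra_simps)
    have up: "T n / n \<le> \<mu> + e * 2 / 3"
    proof -
      have "T n \<le> T ((k+1) * 2 ^ j)" using nk mono by (intro monoD[OF mono]) auto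
      also have "\<dots> \<le> (\<mu> + \<delta>) * ((k + 1) * p)"
      proof -
        have "0 < (k + 1) * p" using p by simp
        moreover have "T ((k + 1) * 2 ^ j) / ((k + 1) * p) < \<mu> + \<delta>"
        proof -
          have "real ((k + 1) * 2 ^ j) = (k + 1) * p" by (simp add: p_def algebra_simps)
          then show ?thesis using J[OF Jj, of "k + 1"] k1 k2 by (auto simp: abs_less_iff)
        qed
        ultimately show ?thesis using pos_divide_less_eq less_imp_le by blast
      qed
      also have "\<dots> = (\<mu> + \<delta>) * (1 + 1 / k) * (k * p)" using kpos by (simp add: field_simps)
      also have "\<dots> \<le> (\<mu> + \<delta>) * (1 + 1 / k) * n"
        using \<mu> \<delta> kpos nkr by (intro mult_left_mono) auto
      finally have "T n / n \<le> (\<mu> + \<delta>) * (1 + 1 / k)" using n0 by (simp add: field_simps)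
      also have "\<dots> = \<mu> + \<delta> + (\<mu> + \<delta>) * (1 / k)" by (simp add: algebra_simps)
      also have "(\<mu> + \<delta>) * (1 / k) \<le> (\<mu> + 1) * (1 / m)"
        using \<mu> \<delta> inv kpos by (intro mult_mono) auto
      finally show ?thesis using minv \<delta> by linarith
    qed
    have low: "T n / n \<ge> \<mu> - e * 2 / 3"
    proof (cases "\<mu> - \<delta> \<le> 0")
      case True
      have "0 \<le> T n" using monoD[OF mono, of 0 n] T0 by simp
      then have "0 \<le> T n / n" by simp
      then show ?thesis using True \<delta> e by linarith
    next
      case False
      have "(\<mu> - \<delta>) * (k * p) \<le> T (k * 2 ^ j)"
      proof -
        have "0 < k * p" using p kpos by simp
        moreover have "\<mu> - \<delta> < T (k * 2 ^ j) / (k * p)"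
          using J[OF Jj, of k] k1 k2 unfolding p_def by (simp add: abs_less_iff)
        ultimately show ?thesis using pos_less_divide_eq less_imp_le by blast
      qed
      also have "\<dots> \<le> T n" using nk by (intro monoD[OF mono]) auto
      finally have 1: "(\<mu> - \<delta>) * (k * p) \<le> T n" .
      have "(1 + 1 / k) * (k * p) = (k + 1) * p" using kpos by (simp add: field_simps)
      then have "n \<le> (1 + 1 / k) * (k * p)" using nkr by linarith
      then have "n * (1 - 1 / k) \<le> (1 + 1 / k) * (k * p) * (1 - 1 / k)"
        using k1 m0 by (intro mult_right_mono) (auto simp: field_simps)
      also have "\<dots> = (1 - 1/k^2) * (k * p)" by (simp add: algebra_simps power2_eq_square)
      also have "\<dots> \<le> 1 * (k * p)" using kpos p by (intro mult_right_mono) auto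
      finally have "n * (1 - 1 / k) \<le> k * p" by simp
      then have "(\<mu> - \<delta>) * (n * (1 - 1 / k)) \<le> (\<mu> - \<delta>) * (k * p)"
        using False by (intro mult_left_mono) auto
      with 1 have "((\<mu> - \<delta>) * (1 - 1 / k)) * n \<le> T n" by (simp add: mult_ac)
      then have "(\<mu> - \<delta>) * (1 - 1 / k) \<le> T n / n" using n0 pos_le_divide_eq by blast
      moreover have "(\<mu> - \<delta>) * (1 - 1 / k) = \<mu> - \<delta> - (\<mu> - \<delta>) * (1 / k)" by (simp add: algebra_simps)
      moreover have "(\<mu> - \<delta>) * (1 / k) \<le> (\<mu> + 1) * (1 / m)"
        using \<mu> \<delta> inv kpos by (intro mult_mono) auto
      ultimately show ?thesis using minv \<delta> by linarith
    qed
    show "norm (T n / n - \<mu>) < e" using up low e by (simp add: abs_less_iff)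
  qed
qed

section \<open>Covariances under strong mixing\<close>

locale mixing_sequence = prob_space M for M :: "'a measure" +
  fixes X :: "nat \<Rightarrow> 'a \<Rightarrow> real"
  assumes rv: "\<And>i. 1 \<le> i \<Longrightarrow> X i \<in> borel_measurable M"
    and mixing: "alpha_mixing M X"
begin

abbreviation \<alpha> :: "nat \<Rightarrow> real" where "\<alpha> \<equiv> alpha_coeff M X"

text \<open>The \<open>\<sigma>\<close>-algebra \<open>sigma_rv M X I\<close> packaged as a measure space, so that measurability of functions
with respect to it can be expressed.\<close>

definition obs :: "nat set \<Rightarrow> 'a measure" where
  "obs I = sigma (space M) (\<Union>i\<in>I. {X i -` S \<inter> space M | S. S \<in> sets borel})"

lemma space_obs [simp]: "space (obs I) = space M"
  unfolding obs_def by (rule space_measure_of) auto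

lemma sets_obs: "sets (obs I) = sigma_rv M X I"
  unfolding obs_def sigma_rv_def by (rule sets_measure_of) auto

lemma X_obs [measurable (raw)]: "i \<in> I \<Longrightarrow> X i \<in> borel_measurable (obs I)"
proof (rule measurableI)
  fix S :: "real set" assume "i \<in> I" "S \<in> sets borel"
  then show "X i -` S \<inter> space (obs I) \<in> sets (obs I)"
    unfolding sets_obs sigma_rv_def by (auto intro!: sigma_sets.Basic)
qed auto

lemma obs_subalgebra: "I \<subseteq> {1..} \<Longrightarrow> subalgebra M (obs I)"
  unfolding subalgebra_def
proof (intro conjI)
  assume I: "I \<subseteq> {1..}"
  show "sets (obs I) \<subseteq> sets M"
    unfolding sets_obs sigma_rv_def
    by (rule sets.sigma_sets_subset) (use I in \<open>auto intro!: measurable_sets rv\<close>)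
qed simp

lemma obs_mono: "I \<subseteq> J \<Longrightarrow> sets (obs I) \<subseteq> sets (obs J)"
  unfolding sets_obs sigma_rv_def by (rule sigma_sets_mono') auto

lemma measurable_obs: "g \<in> borel_measurable (obs I) \<Longrightarrow> I \<subseteq> {1..} \<Longrightarrow> g \<in> borel_measurable M"
  by (rule measurable_from_subalg[OF obs_subalgebra])

lemma measurable_obs_mono:
  "g \<in> borel_measurable (obs I) \<Longrightarrow> I \<subseteq> J \<Longrightarrow> g \<in> borel_measurable (obs J)"
  by (rule measurable_from_subalg[of _ "obs I"]) (use obs_mono in \<open>auto simp: subalgebra_def\<close>)

lemma dependence_le_1: "\<bar>prob (A \<inter> B) - prob A * prob B\<bar> \<le> 1"
proof -
  have "0 \<le> prob A * prob B" "prob A * prob B \<le> 1" using prob_le_1 by (auto intro: mult_le_one)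
  then show ?thesis using prob_le_1[of "A \<inter> B"] measure_nonneg[of M "A \<inter> B"] by linarith
qed

lemma sigma_rv_ne: "sigma_rv M X I \<noteq> {}"
  unfolding sigma_rv_def using sigma_sets.Empty by blast

lemma
  shows alpha_ge: "1 \<le> k \<Longrightarrow> A \<in> sets (obs {1..k}) \<Longrightarrow> B \<in> sets (obs {k + n..}) \<Longrightarrow>
      \<bar>prob (A \<inter> B) - prob A * prob B\<bar> \<le> \<alpha> n"
    and alpha_le: "(\<And>k A B. 1 \<le> k \<Longrightarrow> A \<in> sets (obs {1..k}) \<Longrightarrow> B \<in> sets (obs {k + n..}) \<Longrightarrow>
      \<bar>prob (A \<inter> B) - prob A * prob B\<bar> \<le> c) \<Longrightarrow> \<alpha> n \<le> c"
proof -
  let ?d = "\<lambda>(A, B). \<bar>prob (A \<inter> B) - prob A * prob B\<bar>"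
  let ?P = "\<lambda>k. sigma_rv M X {1..k} \<times> sigma_rv M X {k + n..}"
  have ne: "?P k \<noteq> {}" for k using sigma_rv_ne by auto
  have bdd: "bdd_above (?d ` ?P k)" for k
    using dependence_le_1 by (auto intro!: bdd_aboveI[of _ 1])
  have "(SUP p\<in>?P k. ?d p) \<le> 1" for k
    using dependence_le_1 by (intro cSUP_least[OF ne]) auto
  then have bdd': "bdd_above ((\<lambda>k. SUP p\<in>?P k. ?d p) ` {1..})"
    by (auto intro!: bdd_aboveI[of _ 1])
  show "\<bar>prob (A \<inter> B) - prob A * prob B\<bar> \<le> \<alpha> n"
    if "1 \<le> k" "A \<in> sets (obs {1..k})" "B \<in> sets (obs {k + n..})"
  proof -
    have "?d (A, B) \<le> (SUP p\<in>?P k. ?d p)"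
      using that by (intro cSUP_upper[OF _ bdd]) (auto simp: sets_obs)
    also have "\<dots> \<le> \<alpha> n"
      unfolding alpha_coeff_def using that by (intro cSUP_upper[OF _ bdd']) auto
    finally show ?thesis by simp
  qed
  show "\<alpha> n \<le> c" if "\<And>k A B. 1 \<le> k \<Longrightarrow> A \<in> sets (obs {1..k}) \<Longrightarrow> B \<in> sets (obs {k + n..}) \<Longrightarrow>
      \<bar>prob (A \<inter> B) - prob A * prob B\<bar> \<le> c"
    unfolding alpha_coeff_def
    by (rule cSUP_least, simp, rule cSUP_least[OF ne]) (use that in \<open>auto simp: sets_obs\<close>)
qed

lemma alpha_le_1: "\<alpha> n \<le> 1"
  by (rule alpha_le) (rule dependence_le_1)

lemma alpha_nonneg: "0 \<le> \<alpha> n"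
  using alpha_ge[of 1 "{}" "{}" n] by simp

lemma antimono_alpha: "antimono \<alpha>"
proof (rule antimonoI, rule alpha_le)
  fix m n k :: nat and A B
  assume "m \<le> n" "1 \<le> k" "A \<in> sets (obs {1..k})" "B \<in> sets (obs {k + n..})"
  moreover from this have "B \<in> sets (obs {k + m..})" using obs_mono[of "{k + n..}" "{k + m..}"] by auto
  ultimately show "\<bar>prob (A \<inter> B) - prob A * prob B\<bar> \<le> \<alpha> m" by (intro alpha_ge)
qed

text \<open>Up to an error \<open>w / m\<close> a function \<open>U\<close> with values in \<open>[0, w]\<close> is \<open>w\<close> times the average of the indicators of its
level sets at the heights \<open>w * i / m\<close>; an estimate that holds for all level sets passes to the average and, as \<open>m\<close> grows,
to \<open>U\<close>. This transfers the mixing inequality from events to bounded functions.\<close>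

lemma expectation_mult_le_level_sets:
  fixes U T :: "'a \<Rightarrow> real"
  assumes [measurable]: "U \<in> borel_measurable M" and U: "\<And>x. x \<in> space M \<Longrightarrow> 0 \<le> U x \<and> U x \<le> w"
    and T: "integrable M T" and \<beta>: "\<And>t. \<bar>\<integral>x. indicator {x \<in> space M. t < U x} x * T x \<partial>M\<bar> \<le> \<beta>"
  shows "\<bar>\<integral>x. U x * T x \<partial>M\<bar> \<le> w * \<beta>"
proof (rule field_le_epsilon)
  fix e :: real assume e: "0 < e"
  have [measurable]: "T \<in> borel_measurable M" using T by simp
  have w: "0 \<le> w" using U not_empty by (metis ex_in_conv order_trans)
  obtain m :: nat where m: "w * (\<integral>x. \<bar>T x\<bar> \<partial>M) / e < m" using reals_Archimedean2 by blast
  have m0: "0 < real m"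
  proof -
    have "0 \<le> w * (\<integral>x. \<bar>T x\<bar> \<partial>M) / e" using e w by (auto intro!: divide_nonneg_pos mult_nonneg_nonneg)
    then show ?thesis using m by linarith
  qed
  define D :: "nat \<Rightarrow> 'a \<Rightarrow> real" where "D i = indicator {x \<in> space M. w * i / m < U x}" for i
  define U' where "U' x = (w / m) * (\<Sum>i<m. D i x)" for x
  have approx: "\<bar>U x - U' x\<bar> \<le> w / m" if x: "x \<in> space M" for x
  proof (cases "w = 0")
    case True
    then show ?thesis using U[OF x] by (simp add: U'_def)
  next
    case False
    then have w0: "0 < w" using w by simp
    define p where "p = nat \<lceil>m * U x / w\<rceil>"
    have r: "0 \<le> m * U x / w" "m * U x / w \<le> m" using U[OF x] w0 m0 by (auto simp: field_simps)
    have pm: "p \<le> m" using r unfolding p_def by linarith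
    have "{i. i < m \<and> w * i / m < U x} = {..<p}"
    proof (rule set_eqI)
      fix i :: nat
      have "w * i / m < U x \<longleftrightarrow> i < m * U x / w" using w0 m0 by (simp add: field_simps)
      also have "\<dots> \<longleftrightarrow> i < p" unfolding p_def by (simp add: zless_nat_eq_int_zless less_ceiling_iff)
      finally show "i \<in> {i. i < m \<and> w * i / m < U x} \<longleftrightarrow> i \<in> {..<p}" using pm by auto
    qed
    moreover have "(\<Sum>i<m. D i x)
        = real (card {i. i < m \<and> w * i / m < U x})"
      using x by (simp add: D_def indicator_def sum.If_cases Int_def)
    ultimately have "U' x = (w / m) * p" by (simp add: U'_def)
    moreover have b: "m * U x / w \<le> p" "p \<le> m * U x / w + 1" unfolding p_def using r by linarith+
    have "0 \<le> w / m" using w0 m0 by simp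
    note mult_left_mono[OF b(1) this] mult_left_mono[OF b(2) this]
    moreover have "(w / m) * (m * U x / w) = U x" using w0 m0 by simp
    ultimately show ?thesis by (simp add: distrib_left)
  qed
  have ind: "integrable M (\<lambda>x. D i x * T x)" for i
    by (rule Bochner_Integration.integrable_bound[OF T]) (auto simp: D_def indicator_def)
  have \<beta>': "\<bar>\<integral>x. D i x * T x \<partial>M\<bar> \<le> \<beta>" for i unfolding D_def by (rule \<beta>)
  have intU': "integrable M (\<lambda>x. U' x * T x)"
  proof -
    have "integrable M (\<lambda>x. (w / m) * (\<Sum>i<m. D i x * T x))"
      using ind by (intro Bochner_Integration.integrable_mult_right Bochner_Integration.integrable_sum) auto
    then show ?thesis by (simp add: U'_def sum_distrib_right mult.assoc)
  qed
  have intU: "integrable M (\<lambda>x. U x * T x)"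
  proof (rule Bochner_Integration.integrable_bound[of M "\<lambda>x. w * T x"])
    show "integrable M (\<lambda>x. w * T x)" using T by simp
    show "AE x in M. norm (U x * T x) \<le> norm (w * T x)"
      by (rule AE_I2) (use U w in \<open>auto simp: abs_mult intro!: mult_right_mono\<close>)
  qed simp
  have "\<bar>\<integral>x. U' x * T x \<partial>M\<bar> \<le> w * \<beta>"
  proof -
    have "(\<integral>x. U' x * T x \<partial>M)
        = (w / m) * (\<Sum>i<m. \<integral>x. D i x * T x \<partial>M)"
      using ind by (simp add: U'_def sum_distrib_right mult.assoc)
    also have "\<bar>\<dots>\<bar> \<le> (w / m) * (\<Sum>i<m. \<beta>)"
    proof -
      have "\<bar>\<Sum>i<m. \<integral>x. D i x * T x \<partial>M\<bar> \<le> (\<Sum>i<m. \<beta>)"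
        by (rule order_trans[OF sum_abs sum_mono]) (rule \<beta>')
      moreover have "0 \<le> w / m" using w m0 by simp
      ultimately show ?thesis unfolding abs_mult by (simp only: abs_of_nonneg mult_left_mono)
    qed
    finally show ?thesis using m0 by simp
  qed
  moreover have "\<bar>(\<integral>x. U x * T x \<partial>M) - (\<integral>x. U' x * T x \<partial>M)\<bar> \<le> e"
  proof -
    have "\<bar>(\<integral>x. U x * T x \<partial>M) - (\<integral>x. U' x * T x \<partial>M)\<bar> = \<bar>\<integral>x. (U x - U' x) * T x \<partial>M\<bar>"
      using intU intU' by (simp add: left_diff_distrib)
    also have "\<dots> \<le> (\<integral>x. \<bar>(U x - U' x) * T x\<bar> \<partial>M)" by (rule integral_abs_bound)
    also have "\<dots> \<le> (\<integral>x. (w / m) * \<bar>T x\<bar> \<partial>M)"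
    proof (rule integral_mono)
      show "integrable M (\<lambda>x. \<bar>(U x - U' x) * T x\<bar>)"
        using intU intU' by (auto simp: left_diff_distrib intro!: integrable_abs)
      fix x assume "x \<in> space M"
      then show "\<bar>(U x - U' x) * T x\<bar> \<le> (w / m) * \<bar>T x\<bar>"
        unfolding abs_mult by (intro mult_right_mono approx) auto
    qed (use T in auto)
    also have "\<dots> = w * (\<integral>x. \<bar>T x\<bar> \<partial>M) / m" by simp
    also have "\<dots> \<le> e" using m m0 e by (simp add: field_simps)
    finally show ?thesis .
  qed
  ultimately show "\<bar>\<integral>x. U x * T x \<partial>M\<bar> \<le> w * \<beta> + e" by linarith
qed

text \<open>The previous lemma is applied once in each variable. Centring \<open>V\<close> allows \<open>U\<close> to be shifted to a
nonnegative function at no cost.\<close>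

lemma covariance_bound:
  assumes k: "1 \<le> k" and U: "U \<in> borel_measurable (obs {1..k})" "\<And>x. x \<in> space M \<Longrightarrow> \<bar>U x\<bar> \<le> u"
    and V: "V \<in> borel_measurable (obs {k + l..})" "\<And>x. x \<in> space M \<Longrightarrow> 0 \<le> V x \<and> V x \<le> w"
  shows "\<bar>\<integral>x. U x * (V x - expectation V) \<partial>M\<bar> \<le> 2 * u * w * \<alpha> l"
proof -
  have [measurable]: "U \<in> borel_measurable M" by (rule measurable_obs[OF U(1)]) auto
  have [measurable]: "V \<in> borel_measurable M" by (rule measurable_obs[OF V(1)]) (use k in auto)
  have iV: "integrable M V"
    by (rule integrable_const_bound[of _ w]) (use V in auto)
  have level: "\<bar>\<integral>x. V x * (indicator A x - prob A) \<partial>M\<bar> \<le> w * \<alpha> l" if A: "A \<in> sets (obs {1..k})" for A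
  proof (rule expectation_mult_le_level_sets)
    have AM: "A \<in> sets M" using A obs_subalgebra[of "{1..k}"] by (auto simp: subalgebra_def)
    show "integrable M (\<lambda>x. indicator A x - prob A)" using AM by (auto intro!: integrable_real_indicator simp: emeasure_eq_measure)
    fix t
    let ?B = "{x \<in> space M. t < V x}"
    have B: "?B \<in> sets (obs {k + l..})"
    proof -
      have "{x \<in> space (obs {k + l..}). t < V x} \<in> sets (obs {k + l..})" using V(1) by measurable
      then show ?thesis by simp
    qed
    then have BM: "?B \<in> sets M" by measurable
    have "(\<integral>x. indicator ?B x * (indicator A x - prob A) \<partial>M)
       = (\<integral>x. indicator (A \<inter> ?B) x - prob A * indicator ?B x \<partial>M)"
      by (rule Bochner_Integration.integral_cong) (auto simp: indicator_def)
    also have "\<dots> = prob (A \<inter> ?B) - prob A * prob ?B"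
      using AM BM by (subst Bochner_Integration.integral_diff) (auto simp: emeasure_eq_measure Int_absorb2 sets.sets_into_space)
    finally show "\<bar>\<integral>x. indicator ?B x * (indicator A x - prob A) \<partial>M\<bar> \<le> \<alpha> l"
      using alpha_ge[OF k A B] by simp
  qed (use V in auto)
  have u0: "\<And>x. x \<in> space M \<Longrightarrow> 0 \<le> U x + u \<and> U x + u \<le> 2 * u"
    using U(2) by (force simp: abs_le_iff)
  have iT: "integrable M (\<lambda>x. V x - expectation V)" using iV by simp
  have "\<bar>\<integral>x. (U x + u) * (V x - expectation V) \<partial>M\<bar> \<le> (2 * u) * (w * \<alpha> l)"
  proof (rule expectation_mult_le_level_sets[OF _ u0 iT])
    fix t
    let ?A = "{x \<in> space M. t < U x + u}"
    have A: "?A \<in> sets (obs {1..k})"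
    proof -
      have "{x \<in> space (obs {1..k}). t < U x + u} \<in> sets (obs {1..k})" using U(1) by measurable
      then show ?thesis by simp
    qed
    have AM: "?A \<in> sets M" by measurable
    have i1: "integrable M (\<lambda>x. V x * indicator ?A x)"
      using iV AM by (intro integrable_real_mult_indicator)
    have "(\<integral>x. indicator ?A x * (V x - expectation V) \<partial>M)
        = (\<integral>x. V x * indicator ?A x - expectation V * indicator ?A x \<partial>M)"
      by (rule Bochner_Integration.integral_cong) (auto simp: indicator_def)
    also have "\<dots> = (\<integral>x. V x * indicator ?A x \<partial>M) - expectation V * prob ?A"
      using AM i1 by (subst Bochner_Integration.integral_diff) (auto simp: emeasure_eq_measure Int_absorb2 sets.sets_into_space)
    also have "\<dots> = (\<integral>x. V x * indicator ?A x - V x * prob ?A \<partial>M)"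
      using iV i1 by (subst Bochner_Integration.integral_diff) auto
    also have "\<dots> = (\<integral>x. V x * (indicator ?A x - prob ?A) \<partial>M)"
      by (simp add: right_diff_distrib)
    finally show "\<bar>\<integral>x. indicator ?A x * (V x - expectation V) \<partial>M\<bar> \<le> w * \<alpha> l"
      using level[OF A] by simp
  qed simp
  moreover have "(\<integral>x. (U x + u) * (V x - expectation V) \<partial>M) = (\<integral>x. U x * (V x - expectation V) \<partial>M)"
  proof -
    have "integrable M (\<lambda>x. U x * (V x - expectation V))"
    proof (rule Bochner_Integration.integrable_bound[of M "\<lambda>x. u * (V x - expectation V)"])
      show "AE x in M. norm (U x * (V x - expectation V)) \<le> norm (u * (V x - expectation V))"
        by (rule AE_I2) (use U(2) in \<open>force simp: abs_mult intro!: mult_right_mono\<close>)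
    qed (use iT in auto)
    then have "(\<integral>x. U x * (V x - expectation V) + u * (V x - expectation V) \<partial>M)
        = (\<integral>x. U x * (V x - expectation V) \<partial>M) + u * (\<integral>x. V x - expectation V \<partial>M)"
      using iT by simp
    moreover have "(\<integral>x. V x - expectation V \<partial>M) = 0" using iV by (simp add: prob_space)
    ultimately show ?thesis by (simp add: distrib_right)
  qed
  ultimately show ?thesis by (simp add: mult_ac)
qed

end

section \<open>Covariances of truncated variables in terms of quantiles\<close>

abbreviation unit_interval :: "real measure" where
  "unit_interval \<equiv> restrict_space lborel {0<..<1}"

lemma prob_space_unit_interval: "prob_space unit_interval"
  by (auto simp: emeasure_restrict_space space_restrict_space intro!: prob_spaceI)

lemma space_unit_interval [simp]: "space unit_interval = {0<..<1}"
  by (simp add: space_restrict_space)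

lemma indicator_measurable_unit_interval [measurable]:
  "A \<in> sets borel \<Longrightarrow> (indicator A :: real \<Rightarrow> real) \<in> borel_measurable unit_interval"
  by (rule measurable_restrict_space1) simp

lemma integral_indicator_unit_interval:
  assumes "0 \<le> a" "a \<le> 1"
  shows "(\<integral>s. indicator {..<a} s \<partial>unit_interval) = a"
proof -
  have "(\<integral>s. indicator {..<a} s \<partial>unit_interval) = measure unit_interval ({..<a} \<inter> {0<..<1})"
    by simp
  also have "\<dots> = measure lborel {0<..<a}"
  proof -
    have "{..<a} \<inter> {0<..<1} = {0<..<a}" using assms by auto
    then show ?thesis by (subst measure_restrict_space) auto
  qed
  finally show ?thesis using assms by simp
qed

lemma antimono_measurable_unit_interval:
  fixes g :: "real \<Rightarrow> real"
  assumes "antimono_on {0<..<1} g"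
  shows "g \<in> borel_measurable unit_interval"
proof -
  have "mono_on {0<..<1} (\<lambda>s. - g s)" using assms by (auto simp: monotone_on_def)
  then have "(\<lambda>s. - g s) \<in> borel_measurable (restrict_space borel {0<..<1})"
    by (rule borel_measurable_mono_on_fnc)
  then have "(\<lambda>s. - (- g s)) \<in> borel_measurable (restrict_space borel {0<..<1})" by measurable
  then show ?thesis by (simp cong: measurable_cong_sets add: sets_restrict_space_cong[OF sets_lborel])
qed

context mixing_sequence
begin

text \<open>A discrete inverse of the mixing coefficients. The lag zero is excluded, so that the value is at
least one and its logarithm is nonnegative.\<close>

definition mixing_time :: "real \<Rightarrow> nat" where
  "mixing_time s = (LEAST n. 1 \<le> n \<and> \<alpha> n \<le> s)"

lemma
  assumes "0 < s"
  shows mixing_time_ge_1: "1 \<le> mixing_time s" and alpha_mixing_time: "\<alpha> (mixing_time s) \<le> s"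
proof -
  have "\<forall>\<^sub>F n in sequentially. \<alpha> n < s"
    using mixing assms unfolding alpha_mixing_def by (rule order_tendstoD(2))
  then have "\<forall>\<^sub>F n in sequentially. \<alpha> n < s \<and> 1 \<le> n"
    using eventually_ge_at_top by (rule eventually_conj)
  then have "\<exists>n. 1 \<le> n \<and> \<alpha> n \<le> s"
    by (auto dest!: eventually_happens intro: less_imp_le)
  then have "1 \<le> mixing_time s \<and> \<alpha> (mixing_time s) \<le> s"
    unfolding mixing_time_def by (rule LeastI_ex)
  then show "1 \<le> mixing_time s" "\<alpha> (mixing_time s) \<le> s" by auto
qed

lemma mixing_time_le: "1 \<le> n \<Longrightarrow> \<alpha> n \<le> s \<Longrightarrow> mixing_time s \<le> n"
  unfolding mixing_time_def by (rule Least_le) simp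

lemma antimono_mixing_time: "antimono_on {0<..<1} mixing_time"
  by (rule monotone_onI)
     (metis alpha_mixing_time greaterThanLessThan_iff mixing_time_ge_1 mixing_time_le order_trans)

lemma alpha_greater_iff_mixing_time: "0 < s \<Longrightarrow> 1 \<le> l \<Longrightarrow> s < \<alpha> l \<longleftrightarrow> l < mixing_time s"
proof
  assume "0 < s" "1 \<le> l" "s < \<alpha> l"
  then show "l < mixing_time s"
    using alpha_mixing_time[of s] antimonoD[OF antimono_alpha, of "mixing_time s" l] by force
next
  assume "0 < s" "1 \<le> l" "l < mixing_time s"
  then show "s < \<alpha> l" using mixing_time_le[of l s] by force
qed

lemma mixing_time_meas [measurable]: "(\<lambda>s. real (mixing_time s)) \<in> borel_measurable unit_interval"
  by (rule antimono_measurable_unit_interval) (use antimono_mixing_time in \<open>auto simp: monotone_on_def\<close>)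

text \<open>Counting lags: when a covariance at lag \<open>l\<close> is an integral over the levels below \<open>\<alpha> l\<close>, a
level \<open>s\<close> is charged once for each lag with \<open>s < \<alpha> l\<close>. The additional one stands for the variance.\<close>

lemma card_lags_le:
  assumes "0 < s" "1 \<le> q"
  shows "1 + (\<Sum>l = 1..<q. indicator {..<\<alpha> l} s) \<le> real (min (mixing_time s) q)"
proof -
  have "(\<Sum>l = 1..<q. indicator {..<\<alpha> l} s) = (\<Sum>l = 1..<q. if l < mixing_time s then 1 else 0 :: real)"
    using assms by (intro sum.cong) (auto simp: indicator_def alpha_greater_iff_mixing_time)
  also have "\<dots> = card {l \<in> {1..<q}. l < mixing_time s}"
    by (simp add: sum.If_cases Int_def)
  also have "{l \<in> {1..<q}. l < mixing_time s} = {1..<min (mixing_time s) q}" by auto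
  finally have "1 + (\<Sum>l = 1..<q. indicator {..<\<alpha> l} s) = 1 + real (min (mixing_time s) q - 1)" by simp
  moreover have "1 \<le> min (mixing_time s) q" using assms mixing_time_ge_1[of s] by simp
  ultimately show ?thesis by (simp add: of_nat_diff)
qed

end

text \<open>The setting of the strong law. The function \<open>K\<close> dominates a quantile function of the variables
\<open>f (X i)\<close>: with \<open>s\<close> uniformly distributed on the unit interval, \<open>K s\<close> is stochastically larger than \<open>f (X i)\<close>.
That \<open>K\<close> is at least the mean of \<open>f (X 1)\<close> lets centred variables obey the same bounds as uncentred ones.\<close>

locale dominated_mixing = mixing_sequence +
  fixes f K :: "real \<Rightarrow> real" and \<kappa> :: real
  assumes f_meas [measurable]: "f \<in> borel_measurable borel"
    and f_nonneg: "\<And>x. 0 \<le> f x"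
    and ident: "\<And>i. 1 \<le> i \<Longrightarrow> distr M borel (X i) = distr M borel (X 1)"
    and K_anti: "antimono_on {0<..<1} K"
    and \<kappa>_pos: "0 < \<kappa>" and K_ge: "\<And>s. s \<in> {0<..<1} \<Longrightarrow> \<kappa> \<le> K s"
    and dominated: "\<And>\<psi>. mono \<psi> \<Longrightarrow>
      (\<integral>\<^sup>+\<omega>. ennreal (\<psi> (f (X 1 \<omega>))) \<partial>M) \<le> (\<integral>\<^sup>+s. ennreal (\<psi> (K s)) \<partial>unit_interval)"
    and mean_le: "\<And>s. s \<in> {0<..<1} \<Longrightarrow> expectation (\<lambda>\<omega>. f (X 1 \<omega>)) \<le> K s"
    and integral_finite:
      "(\<integral>\<^sup>+s. ennreal (K s * (1 + ln (mixing_time s))) \<partial>unit_interval) < \<infinity>"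
begin

sublocale U: prob_space unit_interval by (rule prob_space_unit_interval)

lemma X1_meas [measurable]: "X (Suc 0) \<in> borel_measurable M" using rv[of 1] by simp

lemma Y_meas: "1 \<le> i \<Longrightarrow> (\<lambda>\<omega>. f (X i \<omega>)) \<in> borel_measurable M"
  by (rule measurable_compose[OF rv f_meas])

lemma Y_obs: "i \<in> I \<Longrightarrow> (\<lambda>\<omega>. f (X i \<omega>)) \<in> borel_measurable (obs I)"
  by (rule measurable_compose[OF X_obs f_meas])

lemma K_pos: "s \<in> {0<..<1} \<Longrightarrow> 0 < K s" using \<kappa>_pos K_ge[of s] by linarith

lemma K_meas [measurable]: "K \<in> borel_measurable unit_interval"
  by (rule antimono_measurable_unit_interval[OF K_anti])

lemma ident_Y:
  fixes g :: "real \<Rightarrow> real"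
  assumes [measurable]: "g \<in> borel_measurable borel" and i: "1 \<le> i"
  shows expectation_Y: "expectation (\<lambda>\<omega>. g (f (X i \<omega>))) = expectation (\<lambda>\<omega>. g (f (X 1 \<omega>)))"
    and nn_integral_Y: "(\<integral>\<^sup>+\<omega>. ennreal (g (f (X i \<omega>))) \<partial>M) = (\<integral>\<^sup>+\<omega>. ennreal (g (f (X 1 \<omega>))) \<partial>M)"
proof -
  have gf: "(\<lambda>x. g (f x)) \<in> borel_measurable borel" by (rule measurable_compose[OF f_meas assms(1)])
  then have gf': "(\<lambda>x. ennreal (g (f x))) \<in> borel_measurable borel" by measurable
  have "expectation (\<lambda>\<omega>. g (f (X i \<omega>))) = (\<integral>x. g (f x) \<partial>distr M borel (X i))"
    using rv[OF i] by (intro integral_distr[symmetric] gf)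
  also have "\<dots> = (\<integral>x. g (f x) \<partial>distr M borel (X 1))" unfolding ident[OF i] ..
  also have "\<dots> = expectation (\<lambda>\<omega>. g (f (X 1 \<omega>)))"
    using rv[of 1] by (intro integral_distr gf) simp
  finally show "expectation (\<lambda>\<omega>. g (f (X i \<omega>))) = expectation (\<lambda>\<omega>. g (f (X 1 \<omega>)))" .
  have "(\<integral>\<^sup>+\<omega>. ennreal (g (f (X i \<omega>))) \<partial>M) = (\<integral>\<^sup>+x. ennreal (g (f x)) \<partial>distr M borel (X i))"
    using rv[OF i] by (intro nn_integral_distr[symmetric]) (auto simp: gf')
  also have "\<dots> = (\<integral>\<^sup>+x. ennreal (g (f x)) \<partial>distr M borel (X 1))" unfolding ident[OF i] ..
  also have "\<dots> = (\<integral>\<^sup>+\<omega>. ennreal (g (f (X 1 \<omega>))) \<partial>M)"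
    using rv[of 1] by (intro nn_integral_distr) (auto simp: gf')
  finally show "(\<integral>\<^sup>+\<omega>. ennreal (g (f (X i \<omega>))) \<partial>M) = (\<integral>\<^sup>+\<omega>. ennreal (g (f (X 1 \<omega>))) \<partial>M)" .
qed

lemma expectation_le_quantile:
  fixes \<psi> :: "real \<Rightarrow> real"
  assumes \<psi>: "mono \<psi>" "\<And>x. 0 \<le> \<psi> x" and int: "integrable unit_interval (\<lambda>s. \<psi> (K s))" and i: "1 \<le> i"
  shows "integrable M (\<lambda>\<omega>. \<psi> (f (X i \<omega>)))"
    and "expectation (\<lambda>\<omega>. \<psi> (f (X i \<omega>))) \<le> (\<integral>s. \<psi> (K s) \<partial>unit_interval)"
proof -
  have [measurable]: "\<psi> \<in> borel_measurable borel" by (rule borel_measurable_mono[OF \<psi>(1)])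
  have m: "(\<lambda>\<omega>. \<psi> (f (X i \<omega>))) \<in> borel_measurable M" using Y_meas[OF i] by measurable
  have "(\<integral>\<^sup>+\<omega>. ennreal (\<psi> (f (X i \<omega>))) \<partial>M) \<le> (\<integral>\<^sup>+s. ennreal (\<psi> (K s)) \<partial>unit_interval)"
    using dominated[OF \<psi>(1)] nn_integral_Y[OF _ i, of \<psi>] by simp
  also have "\<dots> = ennreal (\<integral>s. \<psi> (K s) \<partial>unit_interval)"
    by (rule nn_integral_eq_integral[OF int]) (simp add: \<psi>)
  finally have le: "(\<integral>\<^sup>+\<omega>. ennreal (\<psi> (f (X i \<omega>))) \<partial>M) \<le> ennreal (\<integral>s. \<psi> (K s) \<partial>unit_interval)" .
  show I: "integrable M (\<lambda>\<omega>. \<psi> (f (X i \<omega>)))"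
    by (rule integrableI_nonneg[OF m]) (use le \<psi> in \<open>auto simp: le_less_trans\<close>)
  have "ennreal (expectation (\<lambda>\<omega>. \<psi> (f (X i \<omega>)))) \<le> ennreal (\<integral>s. \<psi> (K s) \<partial>unit_interval)"
    using le by (subst nn_integral_eq_integral[OF I, symmetric]) (simp_all add: \<psi>)
  then show "expectation (\<lambda>\<omega>. \<psi> (f (X i \<omega>))) \<le> (\<integral>s. \<psi> (K s) \<partial>unit_interval)"
    by (subst (asm) ennreal_le_iff) (auto intro!: Bochner_Integration.integral_nonneg \<psi>)
qed

lemma integrable_K: "integrable unit_interval K"
proof (rule integrableI_nonneg)
  show "AE s in unit_interval. 0 \<le> K s" using K_pos by (auto intro!: AE_I2 less_imp_le)
  have "(\<integral>\<^sup>+s. ennreal (K s) \<partial>unit_interval)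
      \<le> (\<integral>\<^sup>+s. ennreal (K s * (1 + ln (mixing_time s))) \<partial>unit_interval)"
  proof (rule nn_integral_mono, rule ennreal_leI)
    fix s assume "s \<in> space unit_interval"
    then have "0 \<le> ln (mixing_time s)" "0 < K s" using mixing_time_ge_1[of s] K_pos by auto
    then show "K s \<le> K s * (1 + ln (mixing_time s))" by simp
  qed
  then show "(\<integral>\<^sup>+s. ennreal (K s) \<partial>unit_interval) < \<infinity>" using integral_finite by (rule le_less_trans)
qed simp

lemma integrable_Y: "1 \<le> i \<Longrightarrow> integrable M (\<lambda>\<omega>. f (X i \<omega>))"
proof -
  assume i: "1 \<le> i"
  have "integrable unit_interval (\<lambda>s. max 0 (K s))"
    by (rule Bochner_Integration.integrable_bound[OF integrable_K]) (auto intro!: AE_I2)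
  then have "integrable M (\<lambda>\<omega>. max 0 (f (X i \<omega>)))"
    by (intro expectation_le_quantile(1)[OF _ _ _ i]) (auto simp: mono_def)
  then show ?thesis using f_nonneg by (simp add: max_absorb2)
qed

definition Z :: "real \<Rightarrow> nat \<Rightarrow> 'a \<Rightarrow> real" where "Z v i \<omega> = min (f (X i \<omega>)) v"

definition mZ :: "real \<Rightarrow> real" where "mZ v = expectation (Z v 1)"

definition S :: "real \<Rightarrow> nat \<Rightarrow> 'a \<Rightarrow> real" where "S v k \<omega> = (\<Sum>i = 1..k. Z v i \<omega> - mZ v)"

lemma Z_obs: "i \<in> I \<Longrightarrow> Z v i \<in> borel_measurable (obs I)"
  unfolding Z_def[abs_def] using Y_obs[of i I] by measurable

lemma Z_meas: "1 \<le> i \<Longrightarrow> Z v i \<in> borel_measurable M"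
  unfolding Z_def[abs_def] using Y_meas[of i] by measurable

lemma S_obs: "S v k \<in> borel_measurable (obs {1..k})"
  unfolding S_def[abs_def] by (intro borel_measurable_sum borel_measurable_diff Z_obs) auto

lemma S_meas: "S v k \<in> borel_measurable M"
  by (rule measurable_obs[OF S_obs]) auto

lemma S_0 [simp]: "S v 0 = (\<lambda>_. 0)" by (simp add: S_def fun_eq_iff)

lemma S_Suc: "S v (Suc k) \<omega> = S v k \<omega> + (Z v (Suc k) \<omega> - mZ v)"
  by (simp add: S_def)

lemma Z_bounds: "0 \<le> v \<Longrightarrow> 0 \<le> Z v i \<omega>" "0 \<le> v \<Longrightarrow> Z v i \<omega> \<le> v"
  using f_nonneg by (auto simp: Z_def)

lemma integrable_Z: "0 \<le> v \<Longrightarrow> 1 \<le> i \<Longrightarrow> integrable M (Z v i)"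
  by (rule integrable_const_bound[of _ v]) (use Z_bounds Z_meas in auto)

lemma expectation_Z: "1 \<le> i \<Longrightarrow> expectation (Z v i) = mZ v"
  unfolding mZ_def Z_def[abs_def] by (rule expectation_Y) auto

lemma mZ_bounds:
  assumes "0 \<le> v" shows "0 \<le> mZ v" "mZ v \<le> v" "s \<in> {0<..<1} \<Longrightarrow> mZ v \<le> K s"
proof -
  show "0 \<le> mZ v" unfolding mZ_def using Z_bounds[OF assms] by (intro Bochner_Integration.integral_nonneg) auto
  have "mZ v \<le> expectation (\<lambda>_. v)"
    unfolding mZ_def using Z_bounds(2)[OF assms] integrable_Z[OF assms, of 1]
    by (intro integral_mono) auto
  then show "mZ v \<le> v" by (simp add: prob_space)
  have "mZ v \<le> expectation (\<lambda>\<omega>. f (X 1 \<omega>))"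
    unfolding mZ_def using integrable_Y[of 1] integrable_Z[OF assms, of 1]
    by (intro integral_mono) (auto simp: Z_def)
  then show "s \<in> {0<..<1} \<Longrightarrow> mZ v \<le> K s" using mean_le by fastforce
qed

lemma covariance_past:
  assumes v: "0 \<le> v" and i: "1 \<le> i" and V: "V \<in> borel_measurable (obs {1..i})" "\<And>x. x \<in> space M \<Longrightarrow> \<bar>V x\<bar> \<le> u"
  shows "\<bar>\<integral>x. V x * (Z v (i + l) x - mZ v) \<partial>M\<bar> \<le> 2 * u * v * \<alpha> l"
proof -
  have "\<bar>\<integral>x. V x * (Z v (i + l) x - expectation (Z v (i + l))) \<partial>M\<bar> \<le> 2 * u * v * \<alpha> l"
    by (rule covariance_bound[OF i V]) (use Z_obs Z_bounds[OF v] in auto)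
  then show ?thesis using expectation_Z[of "i + l" v] i by simp
qed

text \<open>A covariance inequality in quantile form. The second factor is cut at the height \<open>c\<close> which it exceeds
with probability at most \<open>\<alpha> l\<close>, the first factor is clipped at \<open>c\<close>. The bounded parts contribute
\<open>2 c\<^sup>2 * \<alpha> l\<close> by mixing. The excesses over \<open>c\<close> are estimated by absolute values; they involve only the levels
below \<open>\<alpha> l\<close>, where \<open>K\<close> is at least \<open>c\<close>.\<close>

lemma covariance_lag:
  assumes v: "0 \<le> v" and i: "1 \<le> i" and D: "D \<in> borel_measurable (obs {1..i})"
    "\<And>\<omega>. \<omega> \<in> space M \<Longrightarrow> \<bar>D \<omega>\<bar> \<le> \<bar>Z v i \<omega> - mZ v\<bar>"
  shows "\<bar>\<integral>\<omega>. D \<omega> * (Z v (i + l) \<omega> - mZ v) \<partial>M\<bar>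
    \<le> 2 * (\<integral>s. indicator {..<\<alpha> l} s * (min (K s) v)\<^sup>2 \<partial>unit_interval)"
proof -
  define m a where "m = mZ v" and "a = \<alpha> l"
  have a01: "0 \<le> a" "a \<le> 1" using alpha_nonneg alpha_le_1 by (auto simp: a_def)
  have m: "0 \<le> m" "m \<le> v" "\<And>s. s \<in> {0<..<1} \<Longrightarrow> m \<le> K s" using mZ_bounds[OF v] by (auto simp: m_def)
  \<comment> \<open>The value of K at the level a; at the ends of the unit interval, where K is not controlled, the largest or smallest admissible height.\<close>
  define c where "c = (if a = 0 then v else if a = 1 then m else min (K a) v)"
  have c: "m \<le> c" "c \<le> v" using m a01 by (auto simp: c_def)
  have c0: "0 \<le> c" using c m by linarith
  have below: "c \<le> min (K s) v" if "s \<in> {0<..<1}" "s < a" for s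
    using that m a01 monotone_onD[OF K_anti, of s a] by (auto simp: c_def)
  have above: "min (K s) v \<le> c" if "s \<in> {0<..<1}" "a \<le> s" for s
    using that m a01 monotone_onD[OF K_anti, of a s] by (auto simp: c_def)
  define j where "j = i + l"
  have j: "1 \<le> j" using i by (simp add: j_def)
  define T where "T k \<omega> = max 0 (Z v k \<omega> - c)" for k \<omega>
  define t where "t y = max 0 (min y v - c)" for y
  have Tt: "T k \<omega> = t (f (X k \<omega>))" for k \<omega> by (simp add: T_def t_def Z_def)
  have t_mono: "mono t" by (auto simp: t_def mono_def)
  have t_bd: "0 \<le> t y" "t y \<le> v" for y using c0 v by (auto simp: t_def)
  have [measurable]: "t \<in> borel_measurable borel" by (rule borel_measurable_mono[OF t_mono])
  have it1: "integrable unit_interval (\<lambda>s. t (K s))"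
    by (rule U.integrable_const_bound[of _ v]) (use t_bd in auto)
  have it2: "integrable unit_interval (\<lambda>s. (t (K s))\<^sup>2)"
    by (rule U.integrable_const_bound[of _ "v\<^sup>2"]) (use t_bd in \<open>auto intro!: power_mono\<close>)
  have t2_mono: "mono (\<lambda>y. (t y)\<^sup>2)" using t_mono t_bd by (auto simp: mono_def intro!: power_mono)
  define e1 e2 where "e1 = expectation (T 1)" and "e2 = expectation (\<lambda>\<omega>. (T 1 \<omega>)\<^sup>2)"
  have iT: "integrable M (T k)" "integrable M (\<lambda>\<omega>. (T k \<omega>)\<^sup>2)"
    "expectation (T k) = e1" "expectation (\<lambda>\<omega>. (T k \<omega>)\<^sup>2) = e2" if "1 \<le> k" for k
    using expectation_le_quantile(1)[OF t_mono _ it1 that] expectation_le_quantile(1)[OF t2_mono _ it2 that]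
      expectation_Y[OF _ that, of t] expectation_Y[OF _ that, of "\<lambda>y. (t y)\<^sup>2"] t_bd
    unfolding e1_def e2_def Tt[abs_def] by auto
  have e: "e1 \<le> (\<integral>s. t (K s) \<partial>unit_interval)" "e2 \<le> (\<integral>s. (t (K s))\<^sup>2 \<partial>unit_interval)"
    using expectation_le_quantile(2)[OF t_mono _ it1, of 1] expectation_le_quantile(2)[OF t2_mono _ it2, of 1] t_bd
    unfolding e1_def e2_def Tt[abs_def] by auto
  have e10: "0 \<le> e1" unfolding e1_def T_def by (rule Bochner_Integration.integral_nonneg) auto
  define V where "V \<omega> = min (Z v j \<omega>) c" for \<omega>
  have ZV: "Z v j \<omega> = V \<omega> + T j \<omega>" for \<omega> by (auto simp: V_def T_def)
  have V_obs: "V \<in> borel_measurable (obs {i + l..})"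
    unfolding V_def[abs_def] using Z_obs[of j "{i + l..}" v] by (auto simp: j_def)
  have V_bd: "0 \<le> V \<omega>" "V \<omega> \<le> c" for \<omega> using Z_bounds[OF v] c0 by (auto simp: V_def)
  have iV: "integrable M V"
    by (rule integrable_const_bound[of _ c]) (use V_bd V_obs measurable_obs[OF V_obs] i in auto)
  have EV: "expectation V = m - e1"
  proof -
    have "expectation (Z v j) = expectation (\<lambda>\<omega>. V \<omega> + T j \<omega>)"
      by (rule Bochner_Integration.integral_cong) (auto simp: ZV)
    then show ?thesis using iV iT[OF j] expectation_Z[OF j, of v] by (simp add: m_def)
  qed
  have Dm: "D \<in> borel_measurable M" by (rule measurable_obs[OF D(1)]) auto
  define D' where "D' \<omega> = clip c (D \<omega>)" for \<omega>
  have main: "\<bar>\<integral>\<omega>. D' \<omega> * (V \<omega> - expectation V) \<partial>M\<bar> \<le> 2 * c * c * a"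
    unfolding a_def
  proof (rule covariance_bound[OF i _ _ V_obs])
    show "D' \<in> borel_measurable (obs {1..i})" unfolding D'_def using D(1) by measurable
  qed (use V_bd clip_bound[OF c0] in \<open>auto simp: D'_def\<close>)
  define r where "r \<omega> = c * (T j \<omega> + e1) + c * T i \<omega> + ((T i \<omega>)\<^sup>2 + (T j \<omega>)\<^sup>2) / 2" for \<omega>
  \<comment> \<open>The products of excesses are separated by the inequality of arithmetic and geometric means.\<close>
  have pt: "\<bar>D \<omega> * (Z v j \<omega> - m) - D' \<omega> * (V \<omega> - expectation V)\<bar> \<le> r \<omega>" if \<omega>: "\<omega> \<in> space M" for \<omega>
  proof -
    have T0: "0 \<le> T i \<omega>" "0 \<le> T j \<omega>" by (auto simp: T_def)
    have eq: "D \<omega> * (Z v j \<omega> - m) - D' \<omega> * (V \<omega> - expectation V)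
        = D' \<omega> * (T j \<omega> - e1) + (D \<omega> - D' \<omega>) * (Z v j \<omega> - m)"
      unfolding EV ZV by (simp add: algebra_simps)
    have 1: "\<bar>D' \<omega> * (T j \<omega> - e1)\<bar> \<le> c * (T j \<omega> + e1)"
      unfolding abs_mult using clip_bound[OF c0, of "D \<omega>"] T0 e10 c0
      by (intro mult_mono) (auto simp: D'_def)
    have zj: "\<bar>Z v j \<omega> - m\<bar> \<le> c + T j \<omega>" using Z_bounds[OF v, of j \<omega>] m c by (auto simp: T_def)
    have "\<bar>Z v i \<omega> - m\<bar> \<le> c + T i \<omega>" using Z_bounds[OF v, of i \<omega>] m c by (auto simp: T_def)
    then have "\<bar>D \<omega>\<bar> \<le> c + T i \<omega>" using D(2)[OF \<omega>] by (simp add: m_def)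
    then have "\<bar>D \<omega> - D' \<omega>\<bar> \<le> T i \<omega>" using c0 T0 by (auto simp: D'_def clip_def)
    then have "\<bar>(D \<omega> - D' \<omega>) * (Z v j \<omega> - m)\<bar> \<le> T i \<omega> * (c + T j \<omega>)"
      unfolding abs_mult using zj T0 c0 by (intro mult_mono) auto
    also have "\<dots> \<le> c * T i \<omega> + ((T i \<omega>)\<^sup>2 + (T j \<omega>)\<^sup>2) / 2"
      using sum_squares_bound[of "T i \<omega>" "T j \<omega>"] by (simp add: algebra_simps)
    finally show ?thesis unfolding eq r_def using 1 by linarith
  qed
  have ir: "integrable M r" unfolding r_def[abs_def] using iT[OF i] iT[OF j] by auto
  have Er: "expectation r = 3 * c * e1 + e2"
    unfolding r_def[abs_def] using iT[OF i] iT[OF j] by (simp add: prob_space algebra_simps)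
  have Dbd: "\<bar>D \<omega>\<bar> \<le> v" if "\<omega> \<in> space M" for \<omega>
    using D(2)[OF that] Z_bounds[OF v, of i \<omega>] m unfolding m_def by linarith
  have iD: "integrable M (\<lambda>\<omega>. D \<omega> * (Z v j \<omega> - m))"
  proof (rule integrable_const_bound[of _ "v * v"])
    show "AE \<omega> in M. norm (D \<omega> * (Z v j \<omega> - m)) \<le> v * v"
    proof (rule AE_I2)
      fix \<omega> assume "\<omega> \<in> space M"
      then show "norm (D \<omega> * (Z v j \<omega> - m)) \<le> v * v"
        unfolding real_norm_def abs_mult using Dbd Z_bounds[OF v, of j \<omega>] m v
        by (intro mult_mono) auto
    qed
  qed (use Dm Z_meas[OF j] in auto)
  have iD': "integrable M (\<lambda>\<omega>. D' \<omega> * (V \<omega> - expectation V))"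
  proof (rule Bochner_Integration.integrable_bound[of M "\<lambda>\<omega>. c * (V \<omega> - expectation V)"])
    show "AE \<omega> in M. norm (D' \<omega> * (V \<omega> - expectation V)) \<le> norm (c * (V \<omega> - expectation V))"
      using clip_bound[OF c0] c0 by (auto simp: abs_mult D'_def intro!: AE_I2 mult_right_mono)
    show "(\<lambda>\<omega>. D' \<omega> * (V \<omega> - expectation V)) \<in> borel_measurable M"
      unfolding D'_def using Dm iV by measurable
  qed (use iV in auto)
  have diff: "\<bar>(\<integral>\<omega>. D \<omega> * (Z v j \<omega> - m) \<partial>M) - (\<integral>\<omega>. D' \<omega> * (V \<omega> - expectation V) \<partial>M)\<bar> \<le> expectation r"
  proof -
    have "\<bar>\<integral>\<omega>. D \<omega> * (Z v j \<omega> - m) - D' \<omega> * (V \<omega> - expectation V) \<partial>M\<bar>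
        \<le> (\<integral>\<omega>. \<bar>D \<omega> * (Z v j \<omega> - m) - D' \<omega> * (V \<omega> - expectation V)\<bar> \<partial>M)"
      by (rule integral_abs_bound)
    also have "\<dots> \<le> expectation r"
      by (rule integral_mono[OF _ ir pt]) (use iD iD' in auto)
    finally show ?thesis using iD iD' by simp
  qed
  have ia: "integrable unit_interval (indicator {..<a} :: real \<Rightarrow> real)"
    by (rule U.integrable_const_bound[of _ 1]) (auto intro!: AE_I2 simp: indicator_def)
  from diff have "\<bar>\<integral>\<omega>. D \<omega> * (Z v j \<omega> - m) \<partial>M\<bar> \<le> 2 * c * c * a + 3 * c * e1 + e2"
    using main Er by linarith
  also have "\<dots> \<le> 2 * c * c * (\<integral>s. indicator {..<a} s \<partial>unit_interval)
      + 3 * c * (\<integral>s. t (K s) \<partial>unit_interval) + (\<integral>s. (t (K s))\<^sup>2 \<partial>unit_interval)"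
    using e c0 unfolding integral_indicator_unit_interval[OF a01]
    by (intro add_mono mult_left_mono) auto
  also have "\<dots> = (\<integral>s. 2 * c * c * indicator {..<a} s + 3 * c * t (K s) + (t (K s))\<^sup>2 \<partial>unit_interval)"
    using it1 it2 ia by simp
  also have "\<dots> \<le> (\<integral>s. 2 * (indicator {..<a} s * (min (K s) v)\<^sup>2) \<partial>unit_interval)"
  proof (rule integral_mono)
    show "integrable unit_interval (\<lambda>s. 2 * c * c * indicator {..<a} s + 3 * c * t (K s) + (t (K s))\<^sup>2)"
      using it1 it2 ia by auto
    show "integrable unit_interval (\<lambda>s. 2 * (indicator {..<a} s * (min (K s) v)\<^sup>2))"
    proof (rule U.integrable_const_bound[of _ "2 * v\<^sup>2"])
      show "AE s in unit_interval. norm (2 * (indicator {..<a} s * (min (K s) v)\<^sup>2)) \<le> 2 * v\<^sup>2"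
        using K_pos v by (auto intro!: AE_I2 power_mono simp: indicator_def less_imp_le)
    qed measurable
    fix s assume "s \<in> space unit_interval"
    then have s: "s \<in> {0<..<1}" by simp
    show "2 * c * c * indicator {..<a} s + 3 * c * t (K s) + (t (K s))\<^sup>2
        \<le> 2 * (indicator {..<a} s * (min (K s) v)\<^sup>2)"
    proof (cases "s < a")
      case True
      then have "min (K s) v = c + t (K s)" using below[OF s] by (simp add: t_def)
      then show ?thesis using True c0 t_bd[of "K s"] by (simp add: power2_eq_square algebra_simps)
    next
      case False
      then have "t (K s) = 0" using above[OF s] by (simp add: t_def)
      then show ?thesis using False by simp
    qed
  qed
  finally show ?thesis by (simp add: j_def m_def a_def)
qed

end

section \<open>A deviation inequality for partial sums\<close>

context dominated_mixing
begin

lemma integrable_clip_increment: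
  assumes v: "0 \<le> v" and k: "1 \<le> k" and n: "0 \<le> n"
  shows "integrable M (\<lambda>\<omega>. clip n (S v p \<omega>) * (Z v k \<omega> - mZ v))"
proof (rule integrable_const_bound[of _ "n * v"])
  show "AE \<omega> in M. norm (clip n (S v p \<omega>) * (Z v k \<omega> - mZ v)) \<le> n * v"
  proof (rule AE_I2)
    fix \<omega>
    have "\<bar>Z v k \<omega> - mZ v\<bar> \<le> v"
      using Z_bounds[OF v, of k \<omega>] mZ_bounds(1,2)[OF v] by linarith
    then show "norm (clip n (S v p \<omega>) * (Z v k \<omega> - mZ v)) \<le> n * v"
      unfolding real_norm_def abs_mult using n clip_bound[OF n] by (intro mult_mono) auto
  qed
qed (use S_meas[of v p] Z_meas[OF k, of v] in measurable)

text \<open>The dependence of the new increment on the past is removed in two ways. What happened at least \<open>q\<close> steps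
ago enters through \<open>clip n\<close>, which is bounded by \<open>n\<close>, and costs \<open>2 n v * \<alpha> q\<close>. What happened at a shorter
lag \<open>l\<close> enters through a difference of two values of \<open>clip n\<close>, which is at most as large as the increment at
that time because \<open>clip n\<close> is 1-Lipschitz; so the covariance inequality in quantile form applies.\<close>

lemma drift_bound:
  assumes v: "0 \<le> v" and n: "0 \<le> n" and q: "1 \<le> q"
  shows "expectation (\<lambda>\<omega>. clip n (S v k \<omega>) * (Z v (Suc k) \<omega> - mZ v)) \<le> 2 * n * v * \<alpha> q
    + (\<Sum>l = 1..<q. 2 * (\<integral>s. indicator {..<\<alpha> l} s * (min (K s) v)\<^sup>2 \<partial>unit_interval))"
proof -
  define \<zeta> where "\<zeta> \<omega> = Z v (Suc k) \<omega> - mZ v" for \<omega>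
  define H where "H p \<omega> = clip n (S v p \<omega>)" for p \<omega>
  have int: "integrable M (\<lambda>\<omega>. H p \<omega> * \<zeta> \<omega>)" for p
    unfolding H_def \<zeta>_def by (rule integrable_clip_increment[OF v _ n]) simp
  \<comment> \<open>For indices reaching below zero, truncated subtraction makes the clipped sums vanish, as it should.\<close>
  have tele: "expectation (\<lambda>\<omega>. H k \<omega> * \<zeta> \<omega>) = expectation (\<lambda>\<omega>. H (Suc k - q) \<omega> * \<zeta> \<omega>)
      + (\<Sum>l = 1..<q. expectation (\<lambda>\<omega>. (H (Suc k - l) \<omega> - H (Suc k - Suc l) \<omega>) * \<zeta> \<omega>))"
    using q
  proof (induction q rule: nat_induct_at_least)
    case base
    then show ?case by simp
  next
    case (Suc q)
    have "expectation (\<lambda>\<omega>. (H (Suc k - q) \<omega> - H (Suc k - Suc q) \<omega>) * \<zeta> \<omega>)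
        = expectation (\<lambda>\<omega>. H (Suc k - q) \<omega> * \<zeta> \<omega>) - expectation (\<lambda>\<omega>. H (Suc k - Suc q) \<omega> * \<zeta> \<omega>)"
      using int by (simp only: left_diff_distrib Bochner_Integration.integral_diff)
    then show ?case using Suc by simp
  qed
  have far: "expectation (\<lambda>\<omega>. H (Suc k - q) \<omega> * \<zeta> \<omega>) \<le> 2 * n * v * \<alpha> q"
  proof (cases "Suc k - q = 0")
    case True
    then show ?thesis using n v alpha_nonneg[of q] by (simp add: H_def)
  next
    case False
    have "\<bar>\<integral>\<omega>. H (Suc k - q) \<omega> * (Z v ((Suc k - q) + q) \<omega> - mZ v) \<partial>M\<bar> \<le> 2 * n * v * \<alpha> q"
      by (rule covariance_past[OF v])
        (use False clip_bound[OF n] S_obs[of v "Suc k - q"] in \<open>auto simp: H_def[abs_def]\<close>)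
    then show ?thesis using False by (simp add: \<zeta>_def)
  qed
  have lag: "expectation (\<lambda>\<omega>. (H (Suc k - l) \<omega> - H (Suc k - Suc l) \<omega>) * \<zeta> \<omega>)
      \<le> 2 * (\<integral>s. indicator {..<\<alpha> l} s * (min (K s) v)\<^sup>2 \<partial>unit_interval)" for l
  proof (cases "Suc k \<le> l")
    case True
    then have "expectation (\<lambda>\<omega>. (H (Suc k - l) \<omega> - H (Suc k - Suc l) \<omega>) * \<zeta> \<omega>) = 0" by simp
    moreover have "0 \<le> (\<integral>s. indicator {..<\<alpha> l} s * (min (K s) v)\<^sup>2 \<partial>unit_interval)"
      by (rule Bochner_Integration.integral_nonneg) simp
    ultimately show ?thesis by linarith
  next
    case False
    define i where "i = k - l"
    have i: "Suc k - l = Suc i" "Suc k - Suc l = i" "Suc i + l = Suc k" using False by (auto simp: i_def)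
    have "S v i \<in> borel_measurable (obs {1..Suc i})"
      by (rule measurable_obs_mono[OF S_obs]) auto
    then have meas: "(\<lambda>\<omega>. H (Suc i) \<omega> - H i \<omega>) \<in> borel_measurable (obs {1..Suc i})"
      unfolding H_def using S_obs[of v "Suc i"] by measurable
    have "\<bar>\<integral>\<omega>. (H (Suc i) \<omega> - H i \<omega>) * (Z v (Suc i + l) \<omega> - mZ v) \<partial>M\<bar>
        \<le> 2 * (\<integral>s. indicator {..<\<alpha> l} s * (min (K s) v)\<^sup>2 \<partial>unit_interval)"
    proof (rule covariance_lag[OF v _ meas])
      fix \<omega>
      show "\<bar>H (Suc i) \<omega> - H i \<omega>\<bar> \<le> \<bar>Z v (Suc i) \<omega> - mZ v\<bar>"
        using clip_lipschitz[of n "S v (Suc i) \<omega>" "S v i \<omega>"] by (simp add: H_def S_Suc)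
    qed simp
    then show ?thesis unfolding i \<zeta>_def by simp
  qed
  have "expectation (\<lambda>\<omega>. H k \<omega> * \<zeta> \<omega>) \<le> 2 * n * v * \<alpha> q
    + (\<Sum>l = 1..<q. 2 * (\<integral>s. indicator {..<\<alpha> l} s * (min (K s) v)\<^sup>2 \<partial>unit_interval))"
    unfolding tele by (intro add_mono far sum_mono lag)
  then show ?thesis by (simp add: H_def \<zeta>_def)
qed

lemma increment_square:
  assumes v: "0 \<le> v" and k: "1 \<le> k"
  shows "integrable M (\<lambda>\<omega>. (Z v k \<omega> - mZ v)\<^sup>2)"
    and "expectation (\<lambda>\<omega>. (Z v k \<omega> - mZ v)\<^sup>2) \<le> (\<integral>s. (min (K s) v)\<^sup>2 \<partial>unit_interval)"
proof -
  define \<psi> where "\<psi> y = (max (min y v) (mZ v))\<^sup>2" for y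
  note m = mZ_bounds[OF v]
  have mono: "mono \<psi>" unfolding \<psi>_def using m(1) by (intro monoI power_mono) auto
  have \<psi>K: "\<psi> (K s) = (min (K s) v)\<^sup>2" if "s \<in> {0<..<1}" for s
    using m(2) m(3)[OF that] by (simp add: \<psi>_def max_absorb1)
  have [measurable]: "\<psi> \<in> borel_measurable borel" by (rule borel_measurable_mono[OF mono])
  have int: "integrable unit_interval (\<lambda>s. \<psi> (K s))"
    by (rule U.integrable_const_bound[of _ "v\<^sup>2"])
       (use m(1,2) v in \<open>auto intro!: AE_I2 power_mono simp: \<psi>_def\<close>)
  have le: "(Z v k \<omega> - mZ v)\<^sup>2 \<le> \<psi> (f (X k \<omega>))" for \<omega>
  proof -
    have "\<bar>Z v k \<omega> - mZ v\<bar> \<le> \<bar>max (Z v k \<omega>) (mZ v)\<bar>" using Z_bounds[OF v, of k \<omega>] m by auto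
    then show ?thesis unfolding \<psi>_def Z_def by (rule abs_le_square_iff[THEN iffD1])
  qed
  note E = expectation_le_quantile[OF mono _ int k]
  have i1: "integrable M (\<lambda>\<omega>. \<psi> (f (X k \<omega>)))" by (rule E(1)) (simp add: \<psi>_def)
  show I: "integrable M (\<lambda>\<omega>. (Z v k \<omega> - mZ v)\<^sup>2)"
    by (rule Bochner_Integration.integrable_bound[OF i1])
       (use le Z_meas[OF k, of v] in \<open>auto intro!: AE_I2 simp: \<psi>_def\<close>)
  have "expectation (\<lambda>\<omega>. (Z v k \<omega> - mZ v)\<^sup>2) \<le> expectation (\<lambda>\<omega>. \<psi> (f (X k \<omega>)))"
    by (rule integral_mono[OF I i1 le])
  also have "\<dots> \<le> (\<integral>s. \<psi> (K s) \<partial>unit_interval)" by (rule E(2)) (simp add: \<psi>_def)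
  also have "\<dots> = (\<integral>s. (min (K s) v)\<^sup>2 \<partial>unit_interval)"
    by (rule Bochner_Integration.integral_cong) (auto simp: \<psi>K)
  finally show "expectation (\<lambda>\<omega>. (Z v k \<omega> - mZ v)\<^sup>2) \<le> (\<integral>s. (min (K s) v)\<^sup>2 \<partial>unit_interval)" .
qed

lemma integrable_huber:
  assumes v: "0 \<le> v" and n: "0 \<le> n"
  shows "integrable M (\<lambda>\<omega>. huber n (S v k \<omega>))"
proof (rule integrable_const_bound[of _ "n * (k * v)"])
  show "AE \<omega> in M. norm (huber n (S v k \<omega>)) \<le> n * (k * v)"
  proof (rule AE_I2)
    fix \<omega>
    have "\<bar>S v k \<omega>\<bar> \<le> (\<Sum>i = 1..k. v)"
      unfolding S_def
    proof (rule order_trans[OF sum_abs sum_mono])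
      fix i show "\<bar>Z v i \<omega> - mZ v\<bar> \<le> v"
        using Z_bounds[OF v, of i \<omega>] mZ_bounds(1,2)[OF v] by linarith
    qed
    then have "n * \<bar>S v k \<omega>\<bar> \<le> n * (k * v)" using n by (intro mult_left_mono) auto
    then show "norm (huber n (S v k \<omega>)) \<le> n * (k * v)"
      using huber_upper[OF n, of "S v k \<omega>"] huber_nonneg[OF n, of "S v k \<omega>"] by simp
  qed
qed (use S_meas[of v k] in measurable)

text \<open>Summation of the Taylor expansion of the Huber function over time. The variance of an increment and the
covariances at the lags below \<open>q\<close> combine into a single integral, in which \<open>card_lags_le\<close> counts how
often each level is charged.\<close>

lemma energy_bound:
  assumes v: "0 \<le> v" and n: "0 \<le> n" and q: "1 \<le> q"
  shows "expectation (\<lambda>\<omega>. huber n (S v k \<omega>)) \<le> real k * (2 * n * v * \<alpha> q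
    + 2 * (\<integral>s. min (mixing_time s) q * (min (K s) v)\<^sup>2 \<partial>unit_interval))"
proof -
  let ?J = "\<integral>s. min (mixing_time s) q * (min (K s) v)\<^sup>2 \<partial>unit_interval"
  let ?L = "\<lambda>l. \<integral>s. indicator {..<\<alpha> l} s * (min (K s) v)\<^sup>2 \<partial>unit_interval"
  let ?W = "\<integral>s. (min (K s) v)\<^sup>2 \<partial>unit_interval"
  have K2: "(min (K s) v)\<^sup>2 \<le> v\<^sup>2" if "s \<in> {0<..<1}" for s
    using K_pos[OF that] v by (intro power_mono) auto
  have intW: "integrable unit_interval (\<lambda>s. (min (K s) v)\<^sup>2)"
    by (rule U.integrable_const_bound[of _ "v\<^sup>2"]) (auto intro!: AE_I2 K2)
  have intL: "integrable unit_interval (\<lambda>s. indicator {..<a} s * (min (K s) v)\<^sup>2)" for a :: real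
  proof (rule U.integrable_const_bound[of _ "v\<^sup>2"])
    show "AE s in unit_interval. norm (indicator {..<a} s * (min (K s) v)\<^sup>2) \<le> v\<^sup>2"
      by (auto intro!: AE_I2 K2 simp: indicator_def)
  qed measurable
  have intJ: "integrable unit_interval (\<lambda>s. min (mixing_time s) q * (min (K s) v)\<^sup>2)"
    by (rule U.integrable_const_bound[of _ "q * v\<^sup>2"])
       (auto intro!: AE_I2 K2 mult_mono simp: of_nat_min)
  have lags: "?W + (\<Sum>l = 1..<q. ?L l) \<le> ?J"
  proof -
    define g where "g l s = indicator {..<\<alpha> l} s * (min (K s) v)\<^sup>2" for l s
    have intg: "integrable unit_interval (g l)" for l unfolding g_def by (rule intL)
    have "?W + (\<Sum>l = 1..<q. ?L l)
        = (\<integral>s. (min (K s) v)\<^sup>2 + (\<Sum>l = 1..<q. g l s) \<partial>unit_interval)"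
      using intW intg by (simp add: g_def[symmetric])
    also have "\<dots> \<le> ?J"
    proof (rule integral_mono[OF _ intJ])
      fix s assume "s \<in> space unit_interval"
      then have "1 + (\<Sum>l = 1..<q. indicator {..<\<alpha> l} s) \<le> real (min (mixing_time s) q)"
        by (intro card_lags_le[OF _ q]) simp
      then have "(1 + (\<Sum>l = 1..<q. indicator {..<\<alpha> l} s)) * (min (K s) v)\<^sup>2
          \<le> real (min (mixing_time s) q) * (min (K s) v)\<^sup>2"
        by (rule mult_right_mono) simp
      then show "(min (K s) v)\<^sup>2 + (\<Sum>l = 1..<q. g l s)
          \<le> min (mixing_time s) q * (min (K s) v)\<^sup>2"
        unfolding g_def by (simp only: distrib_right sum_distrib_right mult_1_left)
    qed (use intW intg in auto)
    finally show ?thesis .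
  qed
  have W0: "0 \<le> ?W" by (rule Bochner_Integration.integral_nonneg) simp
  show ?thesis
  proof (induction k)
    case 0
    then show ?case using n by simp
  next
    case (Suc k)
    let ?\<zeta> = "\<lambda>\<omega>. Z v (Suc k) \<omega> - mZ v"
    have i1: "integrable M (\<lambda>\<omega>. clip n (S v k \<omega>) * ?\<zeta> \<omega>)" by (rule integrable_clip_increment[OF v _ n]) simp
    have i2: "integrable M (\<lambda>\<omega>. (?\<zeta> \<omega>)\<^sup>2)" by (rule increment_square[OF v]) simp
    have "expectation (\<lambda>\<omega>. huber n (S v (Suc k) \<omega>))
        \<le> expectation (\<lambda>\<omega>. huber n (S v k \<omega>) + clip n (S v k \<omega>) * ?\<zeta> \<omega> + (?\<zeta> \<omega>)\<^sup>2 / 2)"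
      unfolding S_Suc[abs_def]
      by (rule integral_mono) (use i1 i2 integrable_huber[OF v n, of "Suc k"] integrable_huber[OF v n, of k] huber_step[OF n] in \<open>auto simp: S_Suc\<close>)
    also have "\<dots> = expectation (\<lambda>\<omega>. huber n (S v k \<omega>)) + expectation (\<lambda>\<omega>. clip n (S v k \<omega>) * ?\<zeta> \<omega>)
        + expectation (\<lambda>\<omega>. (?\<zeta> \<omega>)\<^sup>2) / 2"
      using i1 i2 integrable_huber[OF v n, of k] by simp
    also have "\<dots> \<le> k * (2 * n * v * \<alpha> q + 2 * ?J) + (2 * n * v * \<alpha> q + (\<Sum>l = 1..<q. 2 * ?L l)) + ?W / 2"
      using Suc.IH drift_bound[OF v n q, of k] increment_square(2)[OF v, of "Suc k"] by linarith
    also have "\<dots> \<le> k * (2 * n * v * \<alpha> q + 2 * ?J) + (2 * n * v * \<alpha> q + 2 * ?J)"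
    proof -
      have "(\<Sum>l = 1..<q. 2 * ?L l) = 2 * (\<Sum>l = 1..<q. ?L l)" by (simp add: sum_distrib_left)
      then show ?thesis using lags W0 by linarith
    qed
    finally show ?case by (simp add: algebra_simps)
  qed
qed

abbreviation weight :: "real \<Rightarrow> real \<Rightarrow> real" where
  "weight x s \<equiv> scale_weight (K s) (mixing_time s) x"

lemma weight_meas [measurable]: "weight x \<in> borel_measurable unit_interval"
  unfolding scale_weight_def by measurable

lemma weight_bounds:
  assumes "s \<in> {0<..<1}" "0 < x"
  shows "0 \<le> weight x s" "weight x s \<le> min (K s) x"
proof -
  have K: "0 < K s" "1 \<le> real (mixing_time s)" using assms K_pos mixing_time_ge_1[of s] by auto
  show "0 \<le> weight x s" by (rule scale_weight_nonneg) (use K assms in auto)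
  show "weight x s \<le> min (K s) x"
  proof (cases "mixing_time s * K s > x")
    case False
    have "K s \<le> mixing_time s * K s" using K by simp
    moreover have "(mixing_time s * K s) * K s \<le> x * K s" using False K by (intro mult_right_mono) auto
    ultimately show ?thesis using False assms by (simp add: scale_weight_def field_simps)
  qed (simp add: scale_weight_def)
qed

lemma integrable_weight: "0 < x \<Longrightarrow> integrable unit_interval (weight x)"
  by (rule Bochner_Integration.integrable_bound[OF integrable_K])
     (use weight_bounds K_pos in \<open>fastforce intro!: AE_I2 simp: less_imp_le\<close>)+

text \<open>A bound for the bias that truncation at sample size \<open>x\<close> introduces in the mean.\<close>

definition tail :: "real \<Rightarrow> real" where
  "tail x = (\<integral>s. K s * indicator {s. x < mixing_time s * K s} s \<partial>unit_interval)"

lemma tail_meas [measurable]: "(\<lambda>s. indicator {s. x < mixing_time s * K s} s :: real) \<in> borel_measurable unit_interval"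
proof -
  have "(\<lambda>s. if x < mixing_time s * K s then 1 else 0 :: real) \<in> borel_measurable unit_interval" by measurable
  then show ?thesis by (simp add: indicator_def)
qed

lemma integrable_tail: "integrable unit_interval (\<lambda>s. K s * indicator {s. x < mixing_time s * K s} s)"
  by (rule Bochner_Integration.integrable_bound[OF integrable_K]) (auto intro!: AE_I2 simp: indicator_def)

lemma AE_unit_interval_neq: "AE s in unit_interval. s \<noteq> c"
  using AE_lborel_singleton[of c] by (subst AE_restrict_space_iff) auto

text \<open>Three events are responsible for a deviation: some variable exceeds \<open>n\<close>; the parts of the variables between
the truncation level \<open>v\<close> and \<open>n\<close> have a large sum; or the centred sum of the variables truncated at \<open>v\<close> is
large. They are bounded by a union bound, by the first moment, and by the Huber function. With \<open>v\<close> and the block length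
\<open>q\<close> taken from \<open>scale_choice\<close>, all three bounds are multiples of the same integral of \<open>weight n\<close>.

Cutting at \<open>n\<close> first is essential: it caps the levels with \<open>K s > n\<close> in the first-moment
terms, without which the sum over dyadic \<open>n\<close> would also pick up a factor \<open>ln (K s)\<close>.\<close>

lemma deviation_bound:
  assumes n: "1 \<le> n" and \<epsilon>: "0 < \<epsilon>" "\<epsilon> \<le> 1"
  shows "prob {\<omega> \<in> space M. real n * (2 * \<epsilon> + tail n)
      \<le> \<bar>(\<Sum>i = 1..n. f (X i \<omega>)) - n * expectation (\<lambda>\<omega>. f (X 1 \<omega>))\<bar>}
    \<le> 10 / \<epsilon>\<^sup>2 * (\<integral>s. weight n s \<partial>unit_interval)"
proof -
  have n0: "0 < real n" using n by simp
  obtain s0 v :: real and q :: nat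
  where s0: "0 \<le> s0" "s0 \<le> 1" and v: "0 \<le> v" and q: "1 \<le> q" "q * v \<le> n" "\<alpha> q \<le> s0"
    and below: "\<And>s. s \<in> {0<..<1} \<Longrightarrow> s < s0 \<Longrightarrow> n < mixing_time s * K s \<and> v \<le> K s"
    and above: "\<And>s. s \<in> {0<..<1} \<Longrightarrow> s0 < s \<Longrightarrow> mixing_time s * K s \<le> n \<and> K s \<le> v \<and> mixing_time s \<le> q"
    by (rule scale_choice[OF K_anti \<kappa>_pos K_ge antimono_mixing_time _ antimono_alpha _ alpha_le_1 n0])
       (use mixing_time_ge_1 alpha_mixing_time in auto)
  define B where "B = (\<integral>s. weight n s \<partial>unit_interval)"
  define \<mu> where "\<mu> = expectation (\<lambda>\<omega>. f (X 1 \<omega>))"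
  have vn: "v \<le> n"
  proof -
    have "1 * v \<le> q * v" using q v by (intro mult_right_mono) auto
    then show ?thesis using q by simp
  qed
  have w_below: "weight n s = min (K s) n" if "s \<in> {0<..<1}" "s < s0" for s
    using below[OF that] by (simp add: scale_weight_def)
  have w_above: "weight n s = mixing_time s * K s * K s / n" if "s \<in> {0<..<1}" "s0 < s" for s
    using above[OF that] by (simp add: scale_weight_def)
  note iw = integrable_weight[OF n0]
  have neq: "AE s in unit_interval. s \<noteq> s0 \<and> s \<in> {0<..<1}"
    using AE_unit_interval_neq[of s0] AE_space by eventually_elim auto
  have energy: "expectation (\<lambda>\<omega>. huber n (S v n \<omega>)) \<le> 4 * (real n)\<^sup>2 * B"
  proof -
    \<comment> \<open>The cost of mixing at lag q is a first-moment term: v is at most K on all levels left of s0.\<close>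
    have 1: "v * \<alpha> q \<le> B"
    proof -
      have ia: "integrable unit_interval (\<lambda>s. v * indicator {..<s0} s)"
      proof (rule U.integrable_const_bound[of _ v])
        show "AE s in unit_interval. norm (v * indicator {..<s0} s) \<le> v"
          using v by (auto intro!: AE_I2 simp: indicator_def)
      qed measurable
      have "v * \<alpha> q \<le> v * s0" using v q by (intro mult_left_mono)
      also have "\<dots> = (\<integral>s. v * indicator {..<s0} s \<partial>unit_interval)"
        using integral_indicator_unit_interval[OF s0] by simp
      also have "\<dots> \<le> B"
        unfolding B_def
      proof (rule integral_mono[OF ia iw])
        fix s assume "s \<in> space unit_interval"
        then have s: "s \<in> {0<..<1}" by simp
        show "v * indicator {..<s0} s \<le> weight n s"
          using w_below[OF s] below[OF s] weight_bounds(1)[OF s n0] vn by (cases "s < s0") auto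
      qed
      finally show ?thesis .
    qed
    \<comment> \<open>Left of s0 the integrand is at most (q * v) * v, where q * v is at most n; right of s0 it is at most n times the weight.\<close>
    have 2: "(\<integral>s. min (mixing_time s) q * (min (K s) v)\<^sup>2 \<partial>unit_interval) \<le> n * B"
    proof -
      have "(\<integral>s. min (mixing_time s) q * (min (K s) v)\<^sup>2 \<partial>unit_interval) \<le> (\<integral>s. n * weight n s \<partial>unit_interval)"
      proof (rule integral_mono_AE)
        show "integrable unit_interval (\<lambda>s. min (mixing_time s) q * (min (K s) v)\<^sup>2)"
        proof (rule U.integrable_const_bound[of _ "q * v\<^sup>2"])
          show "AE s in unit_interval. norm (min (mixing_time s) q * (min (K s) v)\<^sup>2) \<le> q * v\<^sup>2"
            using K_pos v by (auto intro!: AE_I2 mult_mono power_mono simp: of_nat_min less_imp_le)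
        qed (simp add: of_nat_min)
        show "AE s in unit_interval. min (mixing_time s) q * (min (K s) v)\<^sup>2 \<le> n * weight n s"
          using neq
        proof eventually_elim
          case (elim s)
          then have s: "s \<in> {0<..<1}" by simp
          show ?case
          proof (cases "s < s0")
            case True
            have "real (min (mixing_time s) q) * (min (K s) v)\<^sup>2 \<le> q * v\<^sup>2"
              using K_pos[OF s] v by (intro mult_mono power_mono) auto
            also have "\<dots> = (q * v) * v" by (simp add: power2_eq_square)
            also have "\<dots> \<le> n * min (K s) n"
              using q(2) v vn below[OF s True] by (intro mult_mono) auto
            finally show ?thesis using w_below[OF s True] by simp
          next
            case False
            then have s': "s0 < s" using elim by simp
            have "real (min (mixing_time s) q) * (min (K s) v)\<^sup>2 \<le> mixing_time s * (K s)\<^sup>2"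
              using K_pos[OF s] v by (intro mult_mono power_mono) auto
            also have "\<dots> = n * weight n s" using w_above[OF s s'] n0 by (simp add: power2_eq_square)
            finally show ?thesis .
          qed
        qed
      qed (use iw in simp)
      then show ?thesis using iw by (simp add: B_def)
    qed
    have "expectation (\<lambda>\<omega>. huber n (S v n \<omega>))
        \<le> n * (2 * real n * v * \<alpha> q + 2 * (\<integral>s. min (mixing_time s) q * (min (K s) v)\<^sup>2 \<partial>unit_interval))"
      by (rule energy_bound[OF v _ q(1)]) simp
    also have "\<dots> \<le> n * (2 * real n * B + 2 * (n * B))"
    proof -
      have "2 * real n * (v * \<alpha> q) \<le> 2 * real n * B" using 1 by (intro mult_left_mono) auto
      then have "2 * real n * v * \<alpha> q \<le> 2 * real n * B" by (simp only: mult.assoc)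
      then show ?thesis using 2 by (intro mult_left_mono add_mono) auto
    qed
    finally show ?thesis by (simp add: power2_eq_square algebra_simps)
  qed
  define A1 where "A1 = {\<omega> \<in> space M. \<epsilon> * n \<le> \<bar>S v n \<omega>\<bar>}"
  define R where "R \<omega> = (\<Sum>i = 1..n. min (f (X i \<omega>)) n - Z v i \<omega>)" for \<omega>
  define A2 where "A2 = {\<omega> \<in> space M. \<epsilon> * n \<le> R \<omega>}"
  define E where "E i = {\<omega> \<in> space M. n < f (X i \<omega>)}" for i
  have Sm: "S v n \<in> borel_measurable M" by (rule S_meas)
  have B0: "0 \<le> B" unfolding B_def
    by (rule Bochner_Integration.integral_nonneg) (use weight_bounds n0 in auto)
  have A1: "A1 \<in> sets M" "prob A1 \<le> 8 / \<epsilon>\<^sup>2 * B"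
  proof -
    show "A1 \<in> sets M" unfolding A1_def using Sm by measurable
    have "(\<epsilon> * n)\<^sup>2 / 2 \<le> huber n x" if "\<epsilon> * n \<le> \<bar>x\<bar>" for x
      by (rule huber_ge) (use that \<epsilon> n0 in \<open>auto intro: mult_left_le_one_le\<close>)
    then have "A1 \<subseteq> {\<omega> \<in> space M. (\<epsilon> * n)\<^sup>2 / 2 \<le> huber n (S v n \<omega>)}"
      unfolding A1_def by blast
    then have "prob A1 \<le> prob {\<omega> \<in> space M. (\<epsilon> * n)\<^sup>2 / 2 \<le> huber n (S v n \<omega>)}"
      by (rule finite_measure_mono) (use Sm in measurable)
    also have "\<dots> \<le> expectation (\<lambda>\<omega>. huber n (S v n \<omega>)) / ((\<epsilon> * n)\<^sup>2 / 2)"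
      by (rule integral_Markov_inequality_measure[of _ _ "{}"])
         (use integrable_huber[OF v, of n n] huber_nonneg[of n] \<epsilon> n0 in auto)
    also have "\<dots> \<le> (4 * (real n)\<^sup>2 * B) / ((\<epsilon> * n)\<^sup>2 / 2)"
      using energy by (intro divide_right_mono) auto
    also have "\<dots> = 8 / \<epsilon>\<^sup>2 * B" using n0 \<epsilon> by (simp add: field_simps)
    finally show "prob A1 \<le> 8 / \<epsilon>\<^sup>2 * B" .
  qed
  have trunc: "integrable M (\<lambda>\<omega>. min (f (X i \<omega>)) n - Z v i \<omega>)"
    "expectation (\<lambda>\<omega>. min (f (X i \<omega>)) n - Z v i \<omega>) \<le> B" if i: "1 \<le> i" for i
  proof -
    define \<psi> where "\<psi> y = max 0 (min y n - v)" for y :: real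
    have mono: "mono \<psi>" by (auto simp: \<psi>_def mono_def)
    have [measurable]: "\<psi> \<in> borel_measurable borel" by (rule borel_measurable_mono[OF mono])
    have eq: "min (f (X i \<omega>)) n - Z v i \<omega> = \<psi> (f (X i \<omega>))" for \<omega>
      using vn by (auto simp: \<psi>_def Z_def min_def max_def)
    have int: "integrable unit_interval (\<lambda>s. \<psi> (K s))"
      by (rule U.integrable_const_bound[of _ n]) (use v in \<open>auto intro!: AE_I2 simp: \<psi>_def\<close>)
    have "(\<integral>s. \<psi> (K s) \<partial>unit_interval) \<le> B"
      unfolding B_def
    proof (rule integral_mono_AE[OF int iw])
      show "AE s in unit_interval. \<psi> (K s) \<le> weight n s"
        using neq
      proof eventually_elim
        case (elim s)
        then have s: "s \<in> {0<..<1}" by simp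
        show ?case
        proof (cases "s < s0")
          case True
          then show ?thesis using w_below[OF s True] K_pos[OF s] v n0 by (auto simp: \<psi>_def)
        next
          case False
          then have "\<psi> (K s) = 0" using above[OF s] elim by (auto simp: \<psi>_def)
          then show ?thesis using weight_bounds(1)[OF s n0] by simp
        qed
      qed
    qed
    then show "integrable M (\<lambda>\<omega>. min (f (X i \<omega>)) n - Z v i \<omega>)"
      "expectation (\<lambda>\<omega>. min (f (X i \<omega>)) n - Z v i \<omega>) \<le> B"
      using expectation_le_quantile[OF mono _ int i] unfolding eq by (auto simp: \<psi>_def)
  qed
  have A2: "A2 \<in> sets M" "prob A2 \<le> 1 / \<epsilon> * B"
  proof -
    have iR: "integrable M R" unfolding R_def[abs_def] using trunc(1) by auto
    show "A2 \<in> sets M" unfolding A2_def using iR by measurable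
    have "expectation R = (\<Sum>i = 1..n. expectation (\<lambda>\<omega>. min (f (X i \<omega>)) n - Z v i \<omega>))"
      unfolding R_def using trunc(1) by (intro Bochner_Integration.integral_sum) auto
    also have "\<dots> \<le> (\<Sum>i = 1..n. B)" by (rule sum_mono, rule trunc(2)) simp
    finally have ER: "expectation R \<le> n * B" by simp
    have "prob A2 \<le> expectation R / (\<epsilon> * n)"
      unfolding A2_def
    proof (rule integral_Markov_inequality_measure[of _ _ "{}"])
      show "AE \<omega> in M. 0 \<le> R \<omega>" unfolding R_def Z_def using vn by (auto intro!: AE_I2 sum_nonneg)
    qed (use iR \<epsilon> n0 in auto)
    also have "\<dots> \<le> n * B / (\<epsilon> * n)" using ER \<epsilon> n0 by (intro divide_right_mono) auto
    also have "\<dots> = 1 / \<epsilon> * B" using n0 by simp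
    finally show "prob A2 \<le> 1 / \<epsilon> * B" .
  qed
  have E: "E i \<in> sets M" "prob (E i) \<le> B / n" if i: "1 \<le> i" for i
  proof -
    define \<psi> where "\<psi> y = (if real n < y then real n else 0)" for y :: real
    have mono: "mono \<psi>" by (auto simp: \<psi>_def mono_def)
    have [measurable]: "\<psi> \<in> borel_measurable borel" by (rule borel_measurable_mono[OF mono])
    have int: "integrable unit_interval (\<lambda>s. \<psi> (K s))"
      by (rule U.integrable_const_bound[of _ n]) (auto intro!: AE_I2 simp: \<psi>_def)
    show Em: "E i \<in> sets M" unfolding E_def using Y_meas[OF i] by measurable
    have "n * prob (E i) = expectation (\<lambda>\<omega>. real n * indicat_real (E i) \<omega>)"
      using Em by (simp add: Int_absorb2 sets.sets_into_space)
    also have "\<dots> = expectation (\<lambda>\<omega>. \<psi> (f (X i \<omega>)))"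
      by (rule Bochner_Integration.integral_cong) (auto simp: \<psi>_def E_def indicator_def)
    also have "\<dots> \<le> (\<integral>s. \<psi> (K s) \<partial>unit_interval)"
      by (rule expectation_le_quantile(2)[OF mono _ int i]) (simp add: \<psi>_def)
    also have "\<dots> \<le> B"
      unfolding B_def
    proof (rule integral_mono[OF int iw])
      fix s assume "s \<in> space unit_interval"
      then have s: "s \<in> {0<..<1}" by simp
      show "\<psi> (K s) \<le> weight n s"
      proof (cases "n < K s")
        case True
        have "K s \<le> mixing_time s * K s" using K_pos[OF s] mixing_time_ge_1[of s] s by simp
        then have "real n < mixing_time s * K s" using True by linarith
        then have "weight n s = min (K s) n" by (simp add: scale_weight_def)
        then show ?thesis using True by (simp add: \<psi>_def)
      qed (use weight_bounds(1)[OF s n0] in \<open>simp add: \<psi>_def\<close>)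
    qed
    finally show "prob (E i) \<le> B / n" using n0 by (simp add: field_simps)
  qed
  define A3 where "A3 = (\<Union>i\<in>{1..n}. E i)"
  have A3: "A3 \<in> sets M" "prob A3 \<le> B"
  proof -
    show "A3 \<in> sets M" unfolding A3_def using E(1) by auto
    have "prob A3 \<le> (\<Sum>i\<in>{1..n}. prob (E i))"
      unfolding A3_def by (rule finite_measure_subadditive_finite) (use E(1) in auto)
    also have "\<dots> \<le> (\<Sum>i\<in>{1..n}. B / n)" using E(2) by (intro sum_mono) auto
    finally show "prob A3 \<le> B" using n0 by simp
  qed
  have centre: "mZ v \<le> \<mu>" "\<mu> - mZ v \<le> tail n"
  proof -
    have eq: "\<mu> - mZ v = expectation (\<lambda>\<omega>. f (X 1 \<omega>) - Z v 1 \<omega>)"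
      unfolding \<mu>_def mZ_def using integrable_Y[of 1] integrable_Z[OF v, of 1] by simp
    have "0 \<le> expectation (\<lambda>\<omega>. f (X 1 \<omega>) - Z v 1 \<omega>)"
      by (rule Bochner_Integration.integral_nonneg) (simp add: Z_def)
    then show "mZ v \<le> \<mu>" using eq by simp
    define \<psi> where "\<psi> y = max 0 (y - v)" for y
    have mono: "mono \<psi>" by (auto simp: \<psi>_def mono_def)
    have [measurable]: "\<psi> \<in> borel_measurable borel" by (rule borel_measurable_mono[OF mono])
    have int: "integrable unit_interval (\<lambda>s. \<psi> (K s))"
      by (rule Bochner_Integration.integrable_bound[OF integrable_K]) (use v in \<open>auto intro!: AE_I2 simp: \<psi>_def\<close>)
    have "\<mu> - mZ v = expectation (\<lambda>\<omega>. \<psi> (f (X 1 \<omega>)))"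
      unfolding eq by (rule Bochner_Integration.integral_cong) (auto simp: \<psi>_def Z_def)
    also have "\<dots> \<le> (\<integral>s. \<psi> (K s) \<partial>unit_interval)"
      by (rule expectation_le_quantile(2)[OF mono _ int]) (auto simp: \<psi>_def)
    also have "\<dots> \<le> tail n"
      unfolding tail_def
    proof (rule integral_mono_AE[OF int integrable_tail])
      show "AE s in unit_interval. \<psi> (K s) \<le> K s * indicator {s. n < mixing_time s * K s} s"
        using neq
      proof eventually_elim
        case (elim s)
        then have s: "s \<in> {0<..<1}" by simp
        show ?case
        proof (cases "s < s0")
          case True
          then show ?thesis using below[OF s True] K_pos[OF s] v by (auto simp: \<psi>_def indicator_def)
        next
          case False
          then have "\<psi> (K s) = 0" using above[OF s] elim by (auto simp: \<psi>_def)
          then show ?thesis using K_pos[OF s] by (simp add: indicator_def)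
        qed
      qed
    qed
    finally show "\<mu> - mZ v \<le> tail n" .
  qed
  have sub: "{\<omega> \<in> space M. real n * (2 * \<epsilon> + tail n) \<le> \<bar>(\<Sum>i = 1..n. f (X i \<omega>)) - n * \<mu>\<bar>} \<subseteq> A1 \<union> A2 \<union> A3"
  proof (rule subsetI, rule ccontr)
    fix \<omega> assume *: "\<omega> \<in> {\<omega> \<in> space M. real n * (2 * \<epsilon> + tail n) \<le> \<bar>(\<Sum>i = 1..n. f (X i \<omega>)) - n * \<mu>\<bar>}"
      and **: "\<omega> \<notin> A1 \<union> A2 \<union> A3"
    then have \<omega>: "\<omega> \<in> space M" by simp
    have 1: "\<bar>S v n \<omega>\<bar> < \<epsilon> * n" using ** \<omega> by (auto simp: A1_def)
    have 2: "R \<omega> < \<epsilon> * n" using ** \<omega> by (auto simp: A2_def)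
    have R0: "0 \<le> R \<omega>" unfolding R_def Z_def using vn by (auto intro!: sum_nonneg)
    have small: "min (f (X i \<omega>)) n = f (X i \<omega>)" if "i \<in> {1..n}" for i
    proof -
      have "\<omega> \<notin> E i" using ** that by (auto simp: A3_def)
      then show ?thesis using \<omega> by (simp add: E_def)
    qed
    have "(\<Sum>i = 1..n. f (X i \<omega>)) = (\<Sum>i = 1..n. min (f (X i \<omega>)) n)"
      by (rule sum.cong[OF refl]) (rule small[symmetric])
    also have "\<dots> = R \<omega> + S v n \<omega> + n * mZ v"
      unfolding R_def S_def by (simp add: sum_subtractf)
    finally have "(\<Sum>i = 1..n. f (X i \<omega>)) - n * \<mu> = R \<omega> + S v n \<omega> - n * (\<mu> - mZ v)"
      by (simp add: algebra_simps)
    moreover have "0 \<le> n * (\<mu> - mZ v)" "n * (\<mu> - mZ v) \<le> n * tail n"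
      using centre n0 by (auto intro!: mult_left_mono)
    ultimately have "\<bar>(\<Sum>i = 1..n. f (X i \<omega>)) - n * \<mu>\<bar> < \<epsilon> * n + \<epsilon> * n + n * tail n"
      using 1 2 R0 by linarith
    also have "\<dots> = n * (2 * \<epsilon> + tail n)" by (simp add: algebra_simps)
    finally show False using * by simp
  qed
  have "prob {\<omega> \<in> space M. real n * (2 * \<epsilon> + tail n) \<le> \<bar>(\<Sum>i = 1..n. f (X i \<omega>)) - n * \<mu>\<bar>} \<le> prob (A1 \<union> A2 \<union> A3)"
    by (rule finite_measure_mono[OF sub]) (use A1 A2 A3 in auto)
  also have "\<dots> \<le> prob A1 + prob A2 + prob A3"
    using measure_Un_le[of "A1 \<union> A2" M A3] measure_Un_le[of A1 M A2] A1 A2 A3 by force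
  also have "\<dots> \<le> 8 / \<epsilon>\<^sup>2 * B + 1 / \<epsilon> * B + B" using A1 A2 A3 by linarith
  also have "\<dots> \<le> 10 / \<epsilon>\<^sup>2 * B"
  proof -
    have "\<epsilon>\<^sup>2 \<le> \<epsilon>" "\<epsilon>\<^sup>2 \<le> 1" using \<epsilon> by (auto simp: power2_eq_square mult_le_one mult_left_le)
    then have "1 / \<epsilon> \<le> 1 / \<epsilon>\<^sup>2" "1 \<le> 1 / \<epsilon>\<^sup>2" using \<epsilon> by (auto simp: field_simps)
    from this[THEN mult_right_mono, OF B0] show ?thesis by simp
  qed
  finally show ?thesis by (simp add: \<mu>_def B_def)
qed

end

section \<open>The strong law of large numbers\<close>

context dominated_mixing
begin

lemma integrable_log: "integrable unit_interval (\<lambda>s. K s * (1 + ln (mixing_time s)))"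
proof (rule integrableI_nonneg[OF _ _ integral_finite])
  show "AE s in unit_interval. 0 \<le> K s * (1 + ln (mixing_time s))"
  proof (rule AE_I2)
    fix s assume "s \<in> space unit_interval"
    then have "0 \<le> ln (real (mixing_time s))" "0 < K s" using mixing_time_ge_1[of s] K_pos by auto
    then show "0 \<le> K s * (1 + ln (mixing_time s))" by simp
  qed
qed measurable

lemma summable_weight:
  fixes k :: real
  assumes k: "1 \<le> k"
  shows "summable (\<lambda>j. \<integral>s. weight (k * 2 ^ j) s \<partial>unit_interval)"
proof (rule summableI_nonneg_bounded)
  let ?C = "\<integral>s. 5 * (K s * (1 + ln (mixing_time s))) \<partial>unit_interval"
  have x: "0 < k * 2 ^ j" for j using k by simp
  show "0 \<le> (\<integral>s. weight (k * 2 ^ j) s \<partial>unit_interval)" for j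
    by (rule Bochner_Integration.integral_nonneg) (use weight_bounds(1)[OF _ x] in auto)
  fix J
  have "(\<Sum>j<J. \<integral>s. weight (k * 2 ^ j) s \<partial>unit_interval)
      = (\<integral>s. (\<Sum>j<J. weight (k * 2 ^ j) s) \<partial>unit_interval)"
    by (rule Bochner_Integration.integral_sum[symmetric]) (rule integrable_weight[OF x])
  also have "\<dots> \<le> ?C"
  proof (rule integral_mono)
    show "integrable unit_interval (\<lambda>s. \<Sum>j<J. weight (k * 2 ^ j) s)"
      using integrable_weight[OF x] by auto
    fix s assume "s \<in> space unit_interval"
    then have s: "0 < K s" "1 \<le> real (mixing_time s)" using K_pos[of s] mixing_time_ge_1[of s] by auto
    have "(\<Sum>j<J. weight (k * 2 ^ j) s) \<le> 5 * K s + K s * log 2 (mixing_time s)"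
      by (rule sum_scale_weight_le) (use s k in auto)
    also have "log 2 (mixing_time s) \<le> 5 * ln (mixing_time s)"
    proof -
      have "1 \<le> 5 * ln (2::real)" using ln_le_minus_one[of "1 / 2 :: real"] by (simp add: ln_div)
      then have "1 * ln (mixing_time s) \<le> (5 * ln 2) * ln (mixing_time s)"
        using s by (intro mult_right_mono) auto
      then show ?thesis by (simp add: log_def field_simps)
    qed
    then have "5 * K s + K s * log 2 (mixing_time s) \<le> 5 * K s + K s * (5 * ln (mixing_time s))"
      using s by (intro add_left_mono mult_left_mono) auto
    finally show "(\<Sum>j<J. weight (k * 2 ^ j) s) \<le> 5 * (K s * (1 + ln (mixing_time s)))"
      by (simp add: algebra_simps)
  qed (use integrable_log in auto)
  finally show "(\<Sum>j<J. \<integral>s. weight (k * 2 ^ j) s \<partial>unit_interval) \<le> ?C" .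
qed

lemma tail_tendsto_0: "1 \<le> k \<Longrightarrow> (\<lambda>j. tail (real k * 2 ^ j)) \<longlonglongrightarrow> 0"
proof -
  assume k: "1 \<le> k"
  have "(\<lambda>j. tail (real k * 2 ^ j)) \<longlonglongrightarrow> (\<integral>s. 0 \<partial>unit_interval)"
    unfolding tail_def
  proof (rule integral_dominated_convergence[where w = K])
    show "AE s in unit_interval. (\<lambda>j. K s * indicator {s. real k * 2 ^ j < mixing_time s * K s} s) \<longlonglongrightarrow> 0"
    proof (rule AE_I2, rule tendsto_eventually)
      fix s
      obtain J :: nat where J: "mixing_time s * K s < 2 ^ J" using real_arch_pow[of 2] by auto
      show "\<forall>\<^sub>F j in sequentially. K s * indicator {s. real k * 2 ^ j < mixing_time s * K s} s = 0"
        using eventually_ge_at_top[of J]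
      proof eventually_elim
        case (elim j)
        have "(2::real) ^ J \<le> 2 ^ j" using elim by (intro power_increasing) auto
        also have "\<dots> \<le> real k * 2 ^ j" using k by simp
        finally show ?case using J by simp
      qed
    qed
    show "AE s in unit_interval. norm (K s * indicator {s. real k * 2 ^ j < mixing_time s * K s} s) \<le> K s" for j
      using K_pos by (auto intro!: AE_I2 simp: indicator_def less_imp_le)
  qed (use integrable_K in auto)
  then show ?thesis by simp
qed

text \<open>The deviation probabilities along \<open>k * 2 ^ j\<close> are summable in \<open>j\<close>, so the Borel-Cantelli lemma
gives convergence along each of these subsequences. Since the variables are nonnegative, their partial
sums are monotone, and the whole sequence follows.\<close>

theorem strong_law:
  "AE \<omega> in M. (\<lambda>n. (\<Sum>i = 1..n. f (X i \<omega>)) / n) \<longlonglongrightarrow> expectation (\<lambda>\<omega>. f (X 1 \<omega>))"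
proof -
  define \<mu> where "\<mu> = expectation (\<lambda>\<omega>. f (X 1 \<omega>))"
  define T where "T \<omega> n = (\<Sum>i = 1..n. f (X i \<omega>))" for \<omega> and n :: nat
  have Tm: "(\<lambda>\<omega>. T \<omega> n) \<in> borel_measurable M" for n
    unfolding T_def by (intro borel_measurable_sum Y_meas) auto
  have dyadic: "AE \<omega> in M. (\<lambda>j. T \<omega> (k * 2 ^ j) / (k * 2 ^ j)) \<longlonglongrightarrow> \<mu>" if k: "1 \<le> k" for k :: nat
  proof -
    have "AE \<omega> in M. \<forall>\<^sub>F j in sequentially.
        \<bar>T \<omega> (k * 2 ^ j) / (k * 2 ^ j) - \<mu>\<bar> < 2 * (1 / Suc r) + tail (real k * 2 ^ j)" for r :: nat
    proof -
      define \<epsilon> where "\<epsilon> = 1 / real (Suc r)"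
      have \<epsilon>: "0 < \<epsilon>" "\<epsilon> \<le> 1" by (auto simp: \<epsilon>_def)
      define N where "N j = k * 2 ^ j" for j :: nat
      have N: "1 \<le> N j" "real (N j) = real k * 2 ^ j" for j using k by (auto simp: N_def)
      define A where "A j = {\<omega> \<in> space M. real (N j) * (2 * \<epsilon> + tail (N j)) \<le> \<bar>T \<omega> (N j) - N j * \<mu>\<bar>}" for j
      have Am: "A j \<in> sets M" for j unfolding A_def using Tm by measurable
      have "AE \<omega> in M. \<forall>\<^sub>F j in sequentially. \<omega> \<in> space M - A j"
      proof (rule borel_cantelli_AE1[OF Am])
        show "summable (\<lambda>j. prob (A j))"
        proof (rule summable_comparison_test')
          show "summable (\<lambda>j. 10 / \<epsilon>\<^sup>2 * (\<integral>s. weight (real k * 2 ^ j) s \<partial>unit_interval))"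
            by (rule summable_mult, rule summable_weight) (use k in simp)
          fix j
          show "norm (prob (A j)) \<le> 10 / \<epsilon>\<^sup>2 * (\<integral>s. weight (real k * 2 ^ j) s \<partial>unit_interval)"
            using deviation_bound[OF N(1)[of j] \<epsilon>] unfolding A_def T_def \<mu>_def N(2)[symmetric] by simp
        qed
      qed (simp add: emeasure_eq_measure)
      then show ?thesis
      proof eventually_elim
        case (elim \<omega>)
        then show ?case
        proof eventually_elim
          case (elim j)
          have n0: "0 < real (N j)" using N(1)[of j] by linarith
          from elim have "\<bar>T \<omega> (N j) - N j * \<mu>\<bar> < real (N j) * (2 * \<epsilon> + tail (N j))" by (auto simp: A_def)
          then have "\<bar>T \<omega> (N j) - N j * \<mu>\<bar> / N j < 2 * \<epsilon> + tail (N j)"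
            using n0 by (simp add: pos_divide_less_eq mult.commute)
          moreover have "\<bar>T \<omega> (N j) - N j * \<mu>\<bar> / N j = \<bar>T \<omega> (N j) / N j - \<mu>\<bar>"
          proof -
            have "T \<omega> (N j) / N j - \<mu> = (T \<omega> (N j) - N j * \<mu>) / N j"
              using n0 by (simp add: diff_divide_distrib)
            then show ?thesis by (simp only: abs_divide abs_of_nat)
          qed
          ultimately show ?case unfolding \<epsilon>_def N(2) unfolding N_def by simp
        qed
      qed
    qed
    then have "AE \<omega> in M. \<forall>r. \<forall>\<^sub>F j in sequentially.
        \<bar>T \<omega> (k * 2 ^ j) / (k * 2 ^ j) - \<mu>\<bar> < 2 * (1 / Suc r) + tail (real k * 2 ^ j)"
      by (simp add: AE_all_countable)
    then show ?thesis
    proof eventually_elim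
      case (elim \<omega>)
      show ?case
      proof (rule tendstoI)
        fix e :: real assume e: "0 < e"
        obtain r :: nat where r: "1 / Suc r < e / 4" using nat_approx_posE[of "e / 4"] e by auto
        have "\<forall>\<^sub>F j in sequentially. tail (real k * 2 ^ j) < e / 2"
          using tail_tendsto_0[OF k] e by (intro order_tendstoD(2)[of _ 0]) auto
        with elim[rule_format, of r]
        show "\<forall>\<^sub>F j in sequentially. dist (T \<omega> (k * 2 ^ j) / real (k * 2 ^ j)) \<mu> < e"
        proof eventually_elim
          case (elim j)
          then show ?case using r unfolding dist_real_def by simp
        qed
      qed
    qed
  qed
  then have "AE \<omega> in M. \<forall>k\<in>{1..}. (\<lambda>j. T \<omega> (k * 2 ^ j) / (k * 2 ^ j)) \<longlonglongrightarrow> \<mu>"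
    by (subst AE_ball_countable) auto
  then show ?thesis
  proof eventually_elim
    case (elim \<omega>)
    have "(\<lambda>n. T \<omega> n / n) \<longlonglongrightarrow> \<mu>"
    proof (rule averages_tendsto_from_dyadic)
      show "mono (T \<omega>)" unfolding T_def by (intro monoI sum_mono2) (use f_nonneg in auto)
      show "0 \<le> \<mu>" unfolding \<mu>_def by (rule Bochner_Integration.integral_nonneg) (rule f_nonneg)
    qed (use elim in \<open>auto simp: T_def\<close>)
    then show ?case by (simp add: T_def \<mu>_def)
  qed
qed

end

section \<open>Domination by quantiles of the weight\<close>

context cdf_distribution
begin

text \<open>The inverse of the survival function: \<open>I\<close> is the left-continuous inverse of the distribution function.\<close>

definition upper_quantile :: "real \<Rightarrow> real" where "upper_quantile s = I (1 - s)"

lemma upper_quantile_le_iff: "s \<in> {0<..<1} \<Longrightarrow> upper_quantile s \<le> x \<longleftrightarrow> 1 - s \<le> cdf M x"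
  unfolding upper_quantile_def by (subst pseudoinverse) auto

lemma antimono_upper_quantile: "antimono_on {0<..<1} upper_quantile"
proof (rule monotone_onI)
  fix r s :: real assume rs: "r \<in> {0<..<1}" "s \<in> {0<..<1}" "r \<le> s"
  have "1 - r \<le> cdf M (upper_quantile r)" using upper_quantile_le_iff[OF rs(1)] by blast
  then have "1 - s \<le> cdf M (upper_quantile r)" using rs by linarith
  then show "upper_quantile s \<le> upper_quantile r" using upper_quantile_le_iff[OF rs(2)] by blast
qed

lemma nn_integral_upper_quantile:
  fixes h :: "real \<Rightarrow> ennreal"
  assumes h [measurable]: "h \<in> borel_measurable borel"
  shows "(\<integral>\<^sup>+s. h (upper_quantile s) \<partial>unit_interval) = (\<integral>\<^sup>+x. h x \<partial>M)"
proof -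
  have "(\<lambda>u. h (I u)) \<in> borel_measurable (restrict_space borel {0<..<1})"
    by (rule measurable_compose[OF measurable_CI h])
  then have m: "(\<lambda>u. h (I u) * indicator {0<..<1} u) \<in> borel_measurable borel"
    by (subst (asm) borel_measurable_restrict_space_iff_ennreal) auto
  have "(\<integral>\<^sup>+x. h x \<partial>M) = (\<integral>\<^sup>+x. h x \<partial>distr unit_interval borel I)" by (simp only: distr_I_eq_M)
  also have "\<dots> = (\<integral>\<^sup>+u. h (I u) \<partial>unit_interval)"
    using measurable_CI by (subst nn_integral_distr) (auto cong: measurable_cong_sets simp: sets_restrict_space_cong[OF sets_lborel])
  also have "\<dots> = (\<integral>\<^sup>+u. h (I u) * indicator {0<..<1} u \<partial>lborel)"
    by (rule nn_integral_restrict_space) simp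
  also have "\<dots> = (\<integral>\<^sup>+s. h (I (1 + - 1 * s)) * indicator {0<..<1} (1 + - 1 * s) \<partial>lborel)"
    by (subst nn_integral_real_affine[OF m, of "- 1" 1]) auto
  also have "\<dots> = (\<integral>\<^sup>+s. h (upper_quantile s) * indicator {0<..<1} s \<partial>lborel)"
    by (rule nn_integral_cong) (auto simp: upper_quantile_def indicator_def)
  also have "\<dots> = (\<integral>\<^sup>+s. h (upper_quantile s) \<partial>unit_interval)"
    by (rule nn_integral_restrict_space[symmetric]) simp
  finally show ?thesis by simp
qed

lemma right_inverse_survival:
  assumes s: "s \<in> {0<..<1}"
  shows "right_inverse (\<lambda>x. 1 - cdf M x) s = ennreal (upper_quantile s)"
proof (rule antisym)
  have iff: "1 - cdf M x > s \<longleftrightarrow> x < upper_quantile s" for x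
    using upper_quantile_le_iff[OF s, of x] by linarith
  show "right_inverse (\<lambda>x. 1 - cdf M x) s \<le> ennreal (upper_quantile s)"
    unfolding right_inverse_def by (rule SUP_least) (auto simp: iff intro!: ennreal_leI)
  show "ennreal (upper_quantile s) \<le> right_inverse (\<lambda>x. 1 - cdf M x) s"
    unfolding right_inverse_def le_SUP_iff
  proof (intro allI impI)
    fix y assume y: "y < ennreal (upper_quantile s)"
    then obtain r where r: "0 \<le> r" "y = ennreal r" by (cases y) auto
    then have "r < upper_quantile s" using y by (simp add: ennreal_less_iff)
    then show "\<exists>x\<in>{x. 0 \<le> x \<and> s < 1 - cdf M x}. y < ennreal x"
      using r by (intro bexI[of _ "(r + upper_quantile s) / 2"]) (auto simp: iff ennreal_less_iff)
  qed
qed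

end

lemma ennreal_log1p_ge:
  assumes "ennreal r \<le> u" "0 \<le> r"
  shows "ennreal (ln (1 + r)) \<le> ennreal_log1p u"
proof (cases u)
  case (real x)
  then have "r \<le> x" using assms by simp
  then show ?thesis using real assms by (auto simp: ennreal_log1p_def intro!: ennreal_leI)
qed (simp add: ennreal_log1p_def)

context mixing_sequence
begin

text \<open>If the mixing time at \<open>s\<close> exceeds one, then the coefficient at the preceding lag is still above \<open>s\<close>, hence above
\<open>s / 2\<close>, so that this lag is at most \<open>\<alpha>\<^sup>\<rightarrow>(s / 2)\<close>.\<close>

lemma ln_mixing_time_le:
  assumes "0 < s"
  shows "ennreal (ln (mixing_time s)) \<le> ennreal_log1p (right_inverse (cadlag_ext \<alpha>) (s / 2))"
proof -
  define r where "r = real (mixing_time s) - 1"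
  have r: "0 \<le> r" using mixing_time_ge_1[OF assms] by (simp add: r_def)
  have "ennreal r \<le> right_inverse (cadlag_ext \<alpha>) (s / 2)"
  proof (cases "mixing_time s = 1")
    case True
    then show ?thesis by (simp add: r_def)
  next
    case False
    define l where "l = mixing_time s - 1"
    have l: "1 \<le> l" "l < mixing_time s" "r = real l"
      using False mixing_time_ge_1[OF assms] by (auto simp: l_def r_def)
    then have "s < \<alpha> l" using alpha_greater_iff_mixing_time[OF assms] by blast
    then have "s / 2 < cadlag_ext \<alpha> r" using assms l by (simp add: cadlag_ext_def)
    then show ?thesis unfolding right_inverse_def using r by (intro SUP_upper) auto
  qed
  then show ?thesis using ennreal_log1p_ge[OF _ r] by (simp add: r_def)
qed

end

locale weighted_mixing = mixing_sequence +
  fixes \<phi> :: "real \<Rightarrow> real" and \<epsilon> :: real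
  assumes \<phi>_meas [measurable]: "\<phi> \<in> borel_measurable borel"
    and \<epsilon>_pos: "0 < \<epsilon>" and \<phi>_ge: "\<And>x. \<epsilon> \<le> \<phi> x"
    and ident_dist: "\<And>i. 1 \<le> i \<Longrightarrow> distr M borel (X i) = distr M borel (X 1)"
    and mean_finite: "(\<integral>\<^sup>+\<omega>. ennreal (\<phi> (X 1 \<omega>)) \<partial>M) < \<infinity>"
    and log_integral_finite: "(\<integral>\<^sup>+ s\<in>{0..1}.
            (ennreal_log1p (right_inverse (cadlag_ext \<alpha>) (s / 2))
              * right_inverse (\<lambda>x. 1 - cdf (distr M borel (\<lambda>\<omega>. \<phi> (X 1 \<omega>))) x) s) \<partial>lborel) < \<infinity>"
begin

lemma X1_measurable [measurable]: "X (Suc 0) \<in> borel_measurable M" using rv[of 1] by simp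

lemma \<phi>_pos: "0 < \<phi> x" using \<epsilon>_pos \<phi>_ge[of x] by linarith

lemma integrable_\<phi>: "integrable M (\<lambda>\<omega>. \<phi> (X 1 \<omega>))"
  by (rule integrableI_nonneg) (use mean_finite \<phi>_pos in \<open>auto simp: less_imp_le\<close>)

text \<open>A multiple of the upper quantile function of \<open>\<phi> (X 1)\<close> serves as the dominating function \<open>K\<close>. Since
the quantile function is at least \<open>\<epsilon>\<close>, a constant factor raises it above the mean of \<open>\<phi> (X 1)\<close>.\<close>

lemma strong_law_weighted:
  assumes f [measurable]: "f \<in> borel_measurable borel" and f0: "\<And>x. 0 \<le> f x" and f\<phi>: "\<And>x. f x \<le> \<phi> x"
  shows "AE \<omega> in M. (\<lambda>n. (\<Sum>i = 1..n. f (X i \<omega>)) / n) \<longlonglongrightarrow> expectation (\<lambda>\<omega>. f (X 1 \<omega>))"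
proof -
  define D where "D = distr M borel (\<lambda>\<omega>. \<phi> (X 1 \<omega>))"
  interpret D: cdf_distribution D
    unfolding D_def cdf_distribution_def by (rule real_distribution_distr) simp
  define Q where "Q = D.upper_quantile"
  define \<mu> where "\<mu> = expectation (\<lambda>\<omega>. \<phi> (X 1 \<omega>))"
  define c where "c = 1 + \<mu> / \<epsilon>"
  define K where "K s = c * Q s" for s
  have \<mu>0: "0 \<le> \<mu>" unfolding \<mu>_def by (rule Bochner_Integration.integral_nonneg) (use \<phi>_pos in \<open>simp add: less_imp_le\<close>)
  have c1: "1 \<le> c" using \<mu>0 \<epsilon>_pos by (simp add: c_def)
  have Q_ge: "\<epsilon> \<le> Q s" if s: "s \<in> {0<..<1}" for s
  proof (rule ccontr)
    assume *: "\<not> \<epsilon> \<le> Q s"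
    have "\<not> \<phi> y \<le> Q s" for y using * \<phi>_ge[of y] by linarith
    then have "{\<omega> \<in> space M. \<phi> (X 1 \<omega>) \<le> Q s} = {}" by simp
    moreover have "cdf D (Q s) = prob {\<omega> \<in> space M. \<phi> (X 1 \<omega>) \<le> Q s}"
      unfolding cdf_def D_def by (subst measure_distr) (auto intro!: arg_cong[where f = prob])
    ultimately have "cdf D (Q s) = 0" by (simp only: measure_empty)
    then show False using D.upper_quantile_le_iff[OF s, of "Q s"] s by (simp add: Q_def)
  qed
  have K_ge: "\<epsilon> \<le> K s" "\<mu> \<le> K s" "Q s \<le> K s" if s: "s \<in> {0<..<1}" for s
  proof -
    have Q0: "0 < Q s" using Q_ge[OF s] \<epsilon>_pos by linarith
    then show "Q s \<le> K s" using c1 by (simp add: K_def)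
    then show "\<epsilon> \<le> K s" using Q_ge[OF s] by linarith
    have "\<mu> = (\<mu> / \<epsilon>) * \<epsilon>" using \<epsilon>_pos by simp
    also have "\<dots> \<le> c * Q s" using Q_ge[OF s] \<epsilon>_pos \<mu>0 by (intro mult_mono) (auto simp: c_def)
    finally show "\<mu> \<le> K s" by (simp add: K_def)
  qed
  have Q_anti: "antimono_on {0<..<1} Q" unfolding Q_def by (rule D.antimono_upper_quantile)
  have K_anti: "antimono_on {0<..<1} K"
    using Q_anti c1 by (auto simp: K_def monotone_on_def)
  have Qm [measurable]: "Q \<in> borel_measurable unit_interval" by (rule antimono_measurable_unit_interval[OF Q_anti])
  have quantile: "(\<integral>\<^sup>+s. h (Q s) \<partial>unit_interval) = (\<integral>\<^sup>+\<omega>. h (\<phi> (X 1 \<omega>)) \<partial>M)"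
    if [measurable]: "h \<in> borel_measurable borel" for h :: "real \<Rightarrow> ennreal"
    unfolding Q_def D.nn_integral_upper_quantile[OF that] by (simp add: D_def nn_integral_distr)
  interpret dominated_mixing M X f K \<epsilon>
  proof
    fix s :: real assume s: "s \<in> {0<..<1}"
    show "\<epsilon> \<le> K s" by (rule K_ge[OF s])
    have "integrable M (\<lambda>\<omega>. f (X 1 \<omega>))"
      by (rule Bochner_Integration.integrable_bound[OF integrable_\<phi>]) (use f0 f\<phi> in \<open>auto intro!: AE_I2 simp: order_trans[OF f\<phi> abs_ge_self]\<close>)
    then have "expectation (\<lambda>\<omega>. f (X 1 \<omega>)) \<le> \<mu>"
      unfolding \<mu>_def using integrable_\<phi> by (intro integral_mono) (auto intro: f\<phi>)
    then show "expectation (\<lambda>\<omega>. f (X 1 \<omega>)) \<le> K s" using K_ge(2)[OF s] by linarith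
  next
    fix \<psi> :: "real \<Rightarrow> real" assume \<psi>: "mono \<psi>"
    have [measurable]: "\<psi> \<in> borel_measurable borel" by (rule borel_measurable_mono[OF \<psi>])
    have "(\<integral>\<^sup>+\<omega>. ennreal (\<psi> (f (X 1 \<omega>))) \<partial>M) \<le> (\<integral>\<^sup>+\<omega>. ennreal (\<psi> (\<phi> (X 1 \<omega>))) \<partial>M)"
      by (intro nn_integral_mono ennreal_leI monoD[OF \<psi>] f\<phi>)
    also have "\<dots> = (\<integral>\<^sup>+s. ennreal (\<psi> (Q s)) \<partial>unit_interval)"
      by (rule quantile[symmetric]) measurable
    also have "\<dots> \<le> (\<integral>\<^sup>+s. ennreal (\<psi> (K s)) \<partial>unit_interval)"
      by (intro nn_integral_mono ennreal_leI monoD[OF \<psi>] K_ge) simp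
    finally show "(\<integral>\<^sup>+\<omega>. ennreal (\<psi> (f (X 1 \<omega>))) \<partial>M) \<le> (\<integral>\<^sup>+s. ennreal (\<psi> (K s)) \<partial>unit_interval)" .
  next
    have "(\<integral>\<^sup>+s. ennreal (K s * (1 + ln (mixing_time s))) \<partial>unit_interval)
        = (\<integral>\<^sup>+s. ennreal c * (ennreal (Q s) + ennreal (Q s * ln (mixing_time s))) \<partial>unit_interval)"
    proof (rule nn_integral_cong)
      fix s assume "s \<in> space unit_interval"
      then have "0 \<le> Q s" "0 \<le> ln (real (mixing_time s))"
        using Q_ge[of s] \<epsilon>_pos mixing_time_ge_1[of s] by auto
      then show "ennreal (K s * (1 + ln (mixing_time s))) = ennreal c * (ennreal (Q s) + ennreal (Q s * ln (mixing_time s)))"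
        using c1 by (simp add: K_def algebra_simps flip: ennreal_mult ennreal_plus)
    qed
    also have "\<dots> = ennreal c * ((\<integral>\<^sup>+s. ennreal (Q s) \<partial>unit_interval)
        + (\<integral>\<^sup>+s. ennreal (Q s * ln (mixing_time s)) \<partial>unit_interval))"
      by (simp add: nn_integral_cmult nn_integral_add)
    also have "\<dots> < \<infinity>"
    proof -
      have 1: "(\<integral>\<^sup>+s. ennreal (Q s) \<partial>unit_interval) < \<infinity>"
        using quantile[of ennreal] mean_finite by simp
      have "(\<integral>\<^sup>+s. ennreal (Q s * ln (mixing_time s)) \<partial>unit_interval)
          = (\<integral>\<^sup>+s. ennreal (Q s * ln (mixing_time s)) * indicator {0<..<1} s \<partial>lborel)"
        by (rule nn_integral_restrict_space) simp
      also have "\<dots> \<le> (\<integral>\<^sup>+ s\<in>{0..1}. (ennreal_log1p (right_inverse (cadlag_ext \<alpha>) (s / 2))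
              * right_inverse (\<lambda>x. 1 - cdf D x) s) \<partial>lborel)"
      proof (rule nn_integral_mono)
        fix s :: real
        show "ennreal (Q s * ln (mixing_time s)) * indicator {0<..<1} s
            \<le> (ennreal_log1p (right_inverse (cadlag_ext \<alpha>) (s / 2))
              * right_inverse (\<lambda>x. 1 - cdf D x) s) * indicator {0..1} s"
        proof (cases "s \<in> {0<..<1}")
          case True
          then have ln0: "0 \<le> ln (real (mixing_time s))" using mixing_time_ge_1[of s] by auto
          have Q0: "0 \<le> Q s" using Q_ge[OF True] \<epsilon>_pos by linarith
          have "ennreal (Q s * ln (mixing_time s)) = ennreal (ln (mixing_time s)) * ennreal (Q s)"
            using ln0 Q0 by (simp add: ennreal_mult mult.commute)
          also have "\<dots> \<le> ennreal_log1p (right_inverse (cadlag_ext \<alpha>) (s / 2)) * right_inverse (\<lambda>x. 1 - cdf D x) s"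
            using ln_mixing_time_le[of s] True D.right_inverse_survival[OF True]
            by (intro mult_mono) (auto simp: Q_def)
          finally show ?thesis using True by (simp add: indicator_def)
        qed simp
      qed
      also have "\<dots> < \<infinity>" using log_integral_finite unfolding D_def .
      finally show ?thesis using 1 by (simp add: ennreal_mult_less_top)
    qed
    finally show "(\<integral>\<^sup>+s. ennreal (K s * (1 + ln (mixing_time s))) \<partial>unit_interval) < \<infinity>" .
  qed (fact f f0 ident_dist K_anti \<epsilon>_pos)+
  show ?thesis by (rule strong_law)
qed

end

section \<open>Weighted Glivenko-Cantelli theorem\<close>

context cdf_distribution
begin

text \<open>The argument of Glivenko and Cantelli: between neighbouring quantiles of order \<open>i / p\<close> the distribution function
grows by at most \<open>1 / p\<close> if the jumps at the quantiles themselves are left out. These jumps are controlled by also requiring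
convergence of the left limits, for which \<open>Gn\<close> stands.\<close>

lemma uniform_convergence_from_quantiles:
  fixes Fn Gn :: "nat \<Rightarrow> real \<Rightarrow> real"
  assumes mono: "\<And>n x y. x \<le> y \<Longrightarrow> Fn n x \<le> Fn n y"
    and left: "\<And>n x y. x < y \<Longrightarrow> Fn n x \<le> Gn n y"
    and bounds: "\<And>n x. 0 \<le> Fn n x" "\<And>n x. Fn n x \<le> 1"
    and lim: "\<And>u. u \<in> \<rat> \<Longrightarrow> u \<in> {0<..<1} \<Longrightarrow> (\<lambda>n. Fn n (I u)) \<longlonglongrightarrow> cdf M (I u)"
      "\<And>u. u \<in> \<rat> \<Longrightarrow> u \<in> {0<..<1} \<Longrightarrow> (\<lambda>n. Gn n (I u)) \<longlonglongrightarrow> measure M {..<I u}"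
    and e: "0 < e"
  shows "\<forall>\<^sub>F n in sequentially. \<forall>x. \<bar>Fn n x - cdf M x\<bar> \<le> e"
proof -
  obtain m :: nat where m: "1 / Suc m < e / 2" using nat_approx_posE[of "e / 2"] e by auto
  define p where "p = Suc m"
  have p: "0 < real p" "2 / p < e" using m by (auto simp: p_def)
  define t where "t i = I (real i / p)" for i
  have grid: "real i / p \<in> \<rat>" "real i / p \<in> {0<..<1}" if "i \<in> {1..<p}" for i
    using that by auto
  have "\<forall>\<^sub>F n in sequentially. \<forall>i\<in>{1..<p}. \<bar>Fn n (t i) - cdf M (t i)\<bar> < 1 / p \<and>
      \<bar>Gn n (t i) - measure M {..<t i}\<bar> < 1 / p"
  proof (rule eventually_ball_finite)
    show "\<forall>i\<in>{1..<p}. \<forall>\<^sub>F n in sequentially. \<bar>Fn n (t i) - cdf M (t i)\<bar> < 1 / p \<and>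
      \<bar>Gn n (t i) - measure M {..<t i}\<bar> < 1 / p"
    proof
      fix i assume i: "i \<in> {1..<p}"
      have "0 < 1 / real p" using p by simp
      from tendstoD[OF lim(1)[OF grid[OF i]] this] tendstoD[OF lim(2)[OF grid[OF i]] this]
      show "\<forall>\<^sub>F n in sequentially. \<bar>Fn n (t i) - cdf M (t i)\<bar> < 1 / p \<and> \<bar>Gn n (t i) - measure M {..<t i}\<bar> < 1 / p"
        unfolding t_def dist_real_def by (rule eventually_conj)
    qed
  qed simp
  then show ?thesis
  proof eventually_elim
    case (elim n)
    show ?case
    proof
      fix x
      have q: "real i / p \<le> cdf M y \<longleftrightarrow> t i \<le> y" if "i \<in> {1..<p}" for i y
        unfolding t_def using grid(2)[OF that] by (intro pseudoinverse) auto
      \<comment> \<open>The cell of the grid that contains F(x), with the value 1 assigned to the last cell.\<close>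
      define i where "i = min (nat \<lfloor>p * cdf M x\<rfloor>) (p - 1)"
      have c01: "0 \<le> cdf M x" "cdf M x \<le> 1" by (auto simp: cdf_nonneg cdf_bounded_prob)
      have fl: "of_int \<lfloor>p * cdf M x\<rfloor> \<le> p * cdf M x" "p * cdf M x < of_int \<lfloor>p * cdf M x\<rfloor> + 1" "0 \<le> \<lfloor>p * cdf M x\<rfloor>"
        using c01 by auto
      have ip: "i < p" by (simp add: i_def p_def)
      have lo: "real i \<le> p * cdf M x" using fl unfolding i_def by linarith
      have pc: "p * cdf M x \<le> p" using c01 by (simp add: mult_left_le)
      have hi: "p * cdf M x \<le> real i + 1"
      proof (cases "nat \<lfloor>p * cdf M x\<rfloor> \<le> p - 1")
        case True
        then have "real i = of_int \<lfloor>p * cdf M x\<rfloor>" using fl by (simp add: i_def)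
        then show ?thesis using fl by linarith
      next
        case False
        then have "real i + 1 = p" by (simp add: i_def p_def)
        then show ?thesis using pc by simp
      qed
      have upper: "Fn n x \<le> (real i + 2) / p"
      proof (cases "Suc i < p")
        case True
        then have "i = nat \<lfloor>p * cdf M x\<rfloor>" by (auto simp: i_def)
        then have "p * cdf M x < real i + 1" using fl by linarith
        then have "\<not> real (Suc i) / p \<le> cdf M x" using p by (simp add: field_simps)
        then have "x < t (Suc i)" using q[of "Suc i" x] True by auto
        then have "Fn n x \<le> Gn n (t (Suc i))" by (rule left)
        also have "\<dots> \<le> measure M {..<t (Suc i)} + 1 / p" using elim True by (force simp: abs_less_iff)
        also have "measure M {..<t (Suc i)} \<le> real (Suc i) / p"
        proof (rule tendsto_upperbound[OF cdf_at_left])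
          show "\<forall>\<^sub>F y in at_left (t (Suc i)). cdf M y \<le> real (Suc i) / p"
            unfolding eventually_at_filter
          proof (intro always_eventually allI impI)
            fix y assume "y \<in> {..<t (Suc i)}"
            then show "cdf M y \<le> real (Suc i) / p" using q[of "Suc i" y] True by auto
          qed
        qed simp
        finally show ?thesis using p by (simp add: field_simps)
      next
        case False
        then have "real i + 1 = p" using ip by linarith
        then have "1 \<le> (real i + 2) / p" using p by simp
        then show ?thesis using bounds(2)[of n x] by linarith
      qed
      have lower: "(real i - 1) / p \<le> Fn n x"
      proof (cases "i = 0")
        case True
        then have "(real i - 1) / p \<le> 0" using p by simp
        then show ?thesis using bounds(1)[of n x] by linarith
      next
        case False
        then have i: "i \<in> {1..<p}" using ip by auto
        have "real i / p \<le> cdf M x" using lo p by (simp add: field_simps)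
        then have "t i \<le> x" using q[OF i] by blast
        then have "Fn n (t i) \<le> Fn n x" by (rule mono)
        moreover have "real i / p \<le> cdf M (t i)" using q[OF i, of "t i"] by simp
        moreover have "cdf M (t i) - 1 / p \<le> Fn n (t i)" using elim i by (force simp: abs_less_iff)
        ultimately show ?thesis by (simp add: diff_divide_distrib)
      qed
      have "real i / p \<le> cdf M x" "cdf M x \<le> (real i + 1) / p" using lo hi p by (auto simp: field_simps)
      then have "\<bar>Fn n x - cdf M x\<bar> \<le> 2 / p"
        using upper lower p by (simp add: abs_le_iff add_divide_distrib diff_divide_distrib)
      then show "\<bar>Fn n x - cdf M x\<bar> \<le> e" using p by linarith
    qed
  qed
qed

end

lemma tendsto_0_ennrealI:
  fixes g :: "nat \<Rightarrow> ennreal"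
  assumes "\<And>e. 0 < e \<Longrightarrow> \<forall>\<^sub>F n in sequentially. g n \<le> ennreal e"
  shows "g \<longlonglongrightarrow> 0"
proof (rule order_tendstoI)
  fix a :: ennreal assume a: "0 < a"
  obtain e :: real where e: "0 < e" "ennreal e < a"
  proof (cases a)
    case (real r)
    then show ?thesis using that[of "r / 2"] a by (auto simp: ennreal_less_iff)
  next
    case top
    then show ?thesis using that[of 1] by simp
  qed
  show "\<forall>\<^sub>F n in sequentially. g n < a"
    using assms[OF e(1)] by eventually_elim (use e(2) in \<open>auto intro: le_less_trans\<close>)
qed simp

context weighted_mixing
begin

lemma empirical_cdf_eq: "empirical_cdf X n \<omega> x = (\<Sum>i = 1..n. indicator {..x} (X i \<omega>)) / n"
  by (simp add: empirical_cdf_def indicator_def)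

text \<open>Scaled by \<open>\<epsilon>\<close>, an indicator function lies below \<open>\<phi>\<close>.\<close>

lemma strong_law_indicator:
  assumes [measurable]: "A \<in> sets borel"
  shows "AE \<omega> in M. (\<lambda>n. (\<Sum>i = 1..n. indicator A (X i \<omega>)) / n) \<longlonglongrightarrow> measure (distr M borel (X 1)) A"
proof -
  have "AE \<omega> in M. (\<lambda>n. (\<Sum>i = 1..n. \<epsilon> * indicator A (X i \<omega>)) / n) \<longlonglongrightarrow> expectation (\<lambda>\<omega>. \<epsilon> * indicator A (X 1 \<omega>))"
    by (rule strong_law_weighted) (use \<epsilon>_pos \<phi>_ge order_trans[OF less_imp_le[OF \<epsilon>_pos] \<phi>_ge] in \<open>auto simp: indicator_def\<close>)
  then show ?thesis
  proof eventually_elim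
    case (elim \<omega>)
    have "expectation (\<lambda>\<omega>. \<epsilon> * indicator A (X 1 \<omega>)) = \<epsilon> * (\<integral>x. indicator A x \<partial>distr M borel (X 1))"
      by (subst integral_distr) auto
    also have "(\<integral>x. indicator A x \<partial>distr M borel (X 1)) = measure (distr M borel (X 1)) A" by simp
    finally have "(\<lambda>n. (\<Sum>i = 1..n. \<epsilon> * indicator A (X i \<omega>)) / n / \<epsilon>) \<longlonglongrightarrow> \<epsilon> * measure (distr M borel (X 1)) A / \<epsilon>"
      using elim \<epsilon>_pos by (intro tendsto_divide) auto
    moreover have "(\<Sum>i = 1..n. \<epsilon> * indicator A (X i \<omega>)) / n / \<epsilon> = (\<Sum>i = 1..n. indicator A (X i \<omega>)) / n" for n
      using \<epsilon>_pos by (simp only: sum_distrib_left[symmetric]) simp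
    moreover have "\<epsilon> * measure (distr M borel (X 1)) A / \<epsilon> = measure (distr M borel (X 1)) A"
      using \<epsilon>_pos by simp
    ultimately show ?case by (simp only:)
  qed
qed

lemma glivenko_cantelli:
  "AE \<omega> in M. \<forall>e>0. \<forall>\<^sub>F n in sequentially. \<forall>x.
    \<bar>empirical_cdf X n \<omega> x - cdf (distr M borel (X 1)) x\<bar> \<le> e"
proof -
  interpret D: cdf_distribution "distr M borel (X 1)"
    unfolding cdf_distribution_def by (rule real_distribution_distr) simp
  let ?U = "\<rat> \<inter> {0<..<1::real}"
  have cU: "countable ?U" by (intro countable_Int1 countable_rat)
  have 1: "AE \<omega> in M. \<forall>u\<in>?U. (\<lambda>n. (\<Sum>i = 1..n. indicator {..D.I u} (X i \<omega>)) / n) \<longlonglongrightarrow> measure (distr M borel (X 1)) {..D.I u}"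
    by (subst AE_ball_countable[OF cU], intro ballI, rule strong_law_indicator) simp
  have 2: "AE \<omega> in M. \<forall>u\<in>?U. (\<lambda>n. (\<Sum>i = 1..n. indicator {..<D.I u} (X i \<omega>)) / n) \<longlonglongrightarrow> measure (distr M borel (X 1)) {..<D.I u}"
    by (subst AE_ball_countable[OF cU], intro ballI, rule strong_law_indicator) simp
  show ?thesis
    using 1 2
  proof eventually_elim
    case (elim \<omega>)
    define Gn where "Gn n x = (\<Sum>i = 1..n. indicator {..<x} (X i \<omega>)) / real n" for n and x :: real
    show ?case
    proof (intro allI impI)
      fix e :: real assume e: "0 < e"
      show "\<forall>\<^sub>F n in sequentially. \<forall>x. \<bar>empirical_cdf X n \<omega> x - cdf (distr M borel (X 1)) x\<bar> \<le> e"
      proof (rule D.uniform_convergence_from_quantiles[where Gn = Gn, OF _ _ _ _ _ _ e])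
        fix n and x y :: real
        show "empirical_cdf X n \<omega> x \<le> empirical_cdf X n \<omega> y" if "x \<le> y"
          unfolding empirical_cdf_eq using that
          by (intro divide_right_mono sum_mono) (auto simp: indicator_def)
        show "empirical_cdf X n \<omega> x \<le> Gn n y" if "x < y"
          unfolding empirical_cdf_eq Gn_def using that
          by (intro divide_right_mono sum_mono) (auto simp: indicator_def)
        show "0 \<le> empirical_cdf X n \<omega> x" unfolding empirical_cdf_eq by (simp add: sum_nonneg)
        have "(\<Sum>i = 1..n. indicator {..x} (X i \<omega>)) \<le> (\<Sum>i = 1..n. 1 :: real)"
          by (intro sum_mono) (auto simp: indicator_def)
        then show "empirical_cdf X n \<omega> x \<le> 1"
          unfolding empirical_cdf_eq by (cases "n = 0") (auto simp: divide_le_eq)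
      next
        fix u :: real assume "u \<in> \<rat>" "u \<in> {0<..<1}"
        then show "(\<lambda>n. empirical_cdf X n \<omega> (D.I u)) \<longlonglongrightarrow> cdf (distr M borel (X 1)) (D.I u)"
          "(\<lambda>n. Gn n (D.I u)) \<longlonglongrightarrow> measure (distr M borel (X 1)) {..<D.I u}"
          using elim unfolding empirical_cdf_eq Gn_def cdf_def by auto
      qed
    qed
  qed
qed

definition tail_weight :: "real \<Rightarrow> real \<Rightarrow> real" where
  "tail_weight r x = \<phi> x * indicator {x. r \<le> \<bar>x\<bar>} x"

lemma tail_weight_measurable [measurable]: "tail_weight r \<in> borel_measurable borel"
  unfolding tail_weight_def by measurable

lemma tail_weight_bounds: "0 \<le> tail_weight r x" "tail_weight r x \<le> \<phi> x"
  using \<phi>_pos[of x] by (auto simp: tail_weight_def indicator_def)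

lemma expectation_tail_weight_tendsto_0:
  "(\<lambda>r. expectation (\<lambda>\<omega>. tail_weight (real r) (X 1 \<omega>))) \<longlonglongrightarrow> 0"
proof -
  have "(\<lambda>r. expectation (\<lambda>\<omega>. tail_weight (real r) (X 1 \<omega>))) \<longlonglongrightarrow> expectation (\<lambda>_. 0)"
  proof (rule integral_dominated_convergence[where w = "\<lambda>\<omega>. \<phi> (X 1 \<omega>)"])
    show "AE \<omega> in M. (\<lambda>r. tail_weight (real r) (X 1 \<omega>)) \<longlonglongrightarrow> 0"
    proof (rule AE_I2, rule tendsto_eventually)
      fix \<omega>
      obtain r0 :: nat where r0: "\<bar>X 1 \<omega>\<bar> < r0" using reals_Archimedean2 by blast
      show "\<forall>\<^sub>F r in sequentially. tail_weight (real r) (X 1 \<omega>) = 0"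
        using eventually_ge_at_top[of r0] by eventually_elim (use r0 in \<open>auto simp: tail_weight_def\<close>)
    qed
    show "AE \<omega> in M. norm (tail_weight (real r) (X 1 \<omega>)) \<le> \<phi> (X 1 \<omega>)" for r
      using tail_weight_bounds by (auto intro!: AE_I2)
  qed (use integrable_\<phi> in auto)
  then show ?thesis by simp
qed

text \<open>To the right of \<open>x\<^sub>0\<close> the weight is nondecreasing, so \<open>\<phi> x\<close> times the indicator of \<open>{x<..}\<close> lies below
\<open>\<phi>\<close>; to the left of \<open>x\<^sub>0\<close> the same holds with \<open>{..x}\<close>. So in the tails the weighted error is bounded, uniformly in
\<open>x\<close>, by averages to which the strong law applies.\<close>

lemma weighted_tail_bound:
  assumes anti: "antimono_on {..x\<^sub>0} \<phi>" and mono: "mono_on {x\<^sub>0..} \<phi>"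
    and r: "\<bar>x\<^sub>0\<bar> \<le> r" "r \<le> \<bar>x\<bar>" and n: "1 \<le> n"
  shows "\<bar>empirical_cdf X n \<omega> x - cdf (distr M borel (X 1)) x\<bar> * \<phi> x
    \<le> (\<Sum>i = 1..n. tail_weight r (X i \<omega>)) / n + expectation (\<lambda>\<omega>. tail_weight r (X 1 \<omega>))"
proof -
  define A where "A = (if 0 \<le> x then {x<..} else {..x})"
  have [measurable]: "A \<in> sets borel" by (simp add: A_def)
  have pt: "\<phi> x * indicator A y \<le> tail_weight r y" for y
  proof (cases "y \<in> A")
    case True
    have "\<phi> x \<le> \<phi> y \<and> r \<le> \<bar>y\<bar>"
    proof (cases "0 \<le> x")
      case True
      then have "x < y" using \<open>y \<in> A\<close> by (simp add: A_def)
      then show ?thesis using True r monotone_onD[OF mono, of x y] by auto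
    next
      case False
      then have "y \<le> x" using \<open>y \<in> A\<close> by (simp add: A_def)
      then show ?thesis using False r monotone_onD[OF anti, of y x] by auto
    qed
    then show ?thesis using True by (simp add: tail_weight_def)
  qed (simp add: tail_weight_bounds)
  define pA where "pA = measure (distr M borel (X 1)) A"
  define nA where "nA = (\<Sum>i = 1..n. indicator A (X i \<omega>)) / real n"
  interpret D: prob_space "distr M borel (X 1)" by (rule prob_space_distr) simp
  have "\<bar>empirical_cdf X n \<omega> x - cdf (distr M borel (X 1)) x\<bar> = \<bar>nA - pA\<bar>"
  proof (cases "0 \<le> x")
    case True
    have "A = space (distr M borel (X 1)) - {..x}" using True by (auto simp: A_def)
    then have "pA = 1 - cdf (distr M borel (X 1)) x"
      unfolding pA_def cdf_def by (simp only:) (rule D.prob_compl, simp)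
    moreover have "nA = 1 - empirical_cdf X n \<omega> x"
    proof -
      have "(\<Sum>i = 1..n. indicator A (X i \<omega>)) = (\<Sum>i = 1..n. 1 - indicator {..x} (X i \<omega>) :: real)"
        using True by (intro sum.cong) (auto simp: A_def indicator_def)
      also have "\<dots> = real n - (\<Sum>i = 1..n. indicator {..x} (X i \<omega>))"
        by (subst sum_subtractf) simp
      finally show ?thesis using n unfolding nA_def empirical_cdf_eq by (simp add: diff_divide_distrib)
    qed
    ultimately show ?thesis by simp
  next
    case False
    then show ?thesis by (simp add: nA_def pA_def A_def empirical_cdf_eq cdf_def)
  qed
  also have "\<bar>nA - pA\<bar> \<le> nA + pA"
  proof -
    have "0 \<le> nA" unfolding nA_def by (simp add: sum_nonneg)
    moreover have "0 \<le> pA" by (simp add: pA_def)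
    ultimately show ?thesis by simp
  qed
  finally have "\<bar>empirical_cdf X n \<omega> x - cdf (distr M borel (X 1)) x\<bar> * \<phi> x \<le> (nA + pA) * \<phi> x"
    using \<phi>_pos[of x] by (intro mult_right_mono) auto
  also have "\<dots> = \<phi> x * nA + \<phi> x * pA" by (simp add: algebra_simps)
  also have "\<phi> x * nA \<le> (\<Sum>i = 1..n. tail_weight r (X i \<omega>)) / n"
  proof -
    have "\<phi> x * nA = (\<Sum>i = 1..n. \<phi> x * indicator A (X i \<omega>)) / real n"
      unfolding nA_def by (simp only: sum_distrib_left times_divide_eq_right)
    also have "\<dots> \<le> (\<Sum>i = 1..n. tail_weight r (X i \<omega>)) / n"
      by (intro divide_right_mono sum_mono pt) simp
    finally show ?thesis .
  qed
  also have "\<phi> x * pA \<le> expectation (\<lambda>\<omega>. tail_weight r (X 1 \<omega>))"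
  proof -
    have "\<phi> x * pA = \<phi> x * (\<integral>y. indicator A y \<partial>distr M borel (X 1))" by (simp add: pA_def)
    also have "\<dots> = expectation (\<lambda>\<omega>. \<phi> x * indicator A (X 1 \<omega>))"
      by (subst integral_distr) auto
    also have "\<dots> \<le> expectation (\<lambda>\<omega>. tail_weight r (X 1 \<omega>))"
    proof (rule integral_mono[OF _ _ pt])
      show "integrable M (\<lambda>\<omega>. tail_weight r (X 1 \<omega>))"
        by (rule Bochner_Integration.integrable_bound[OF integrable_\<phi>])
           (use tail_weight_bounds order_trans[OF tail_weight_bounds(2) abs_ge_self] in \<open>auto intro!: AE_I2\<close>)
      show "integrable M (\<lambda>\<omega>. \<phi> x * indicator A (X 1 \<omega>))"
        by (rule integrable_const_bound[of _ "\<phi> x"])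
           (use \<phi>_pos[of x] in \<open>auto intro!: AE_I2 simp: indicator_def\<close>)
    qed
    finally show ?thesis .
  qed
  finally show ?thesis by simp
qed

text \<open>Outside a large interval the previous lemma bounds the error by a quantity that the strong law drives close to twice a small
expectation. Inside the interval the continuous weight is bounded and the unweighted theorem suffices.\<close>

theorem weighted_glivenko_cantelli:
  assumes weight: "weight_function \<phi>"
  shows "AE \<omega> in M. (\<lambda>n. weighted_norm \<phi>
    (\<lambda>x. empirical_cdf X n \<omega> x - cdf (distr M borel (X 1)) x)) \<longlonglongrightarrow> 0"
proof -
  obtain x\<^sub>0 where cont: "continuous_on UNIV \<phi>" and anti: "antimono_on {..x\<^sub>0} \<phi>" and mono: "mono_on {x\<^sub>0..} \<phi>"
    using weight unfolding weight_function_def by blast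
  have "AE \<omega> in M. \<forall>r::nat. (\<lambda>n. (\<Sum>i = 1..n. tail_weight (real r) (X i \<omega>)) / n)
      \<longlonglongrightarrow> expectation (\<lambda>\<omega>. tail_weight (real r) (X 1 \<omega>))"
    unfolding AE_all_countable by (intro allI strong_law_weighted) (simp_all add: tail_weight_bounds)
  with glivenko_cantelli show ?thesis
  proof eventually_elim
    case (elim \<omega>)
    let ?F = "cdf (distr M borel (X 1))"
    show ?case
    proof (rule tendsto_0_ennrealI)
      fix e :: real assume e: "0 < e"
      define E where "E r = expectation (\<lambda>\<omega>. tail_weight (real r) (X 1 \<omega>))" for r :: nat
      have "\<forall>\<^sub>F r in sequentially. E r < e / 4"
        unfolding E_def by (rule order_tendstoD(2)[OF expectation_tail_weight_tendsto_0]) (use e in simp)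
      moreover have "\<forall>\<^sub>F r in sequentially. \<bar>x\<^sub>0\<bar> \<le> real r"
        by (rule eventually_sequentiallyI[of "nat \<lceil>\<bar>x\<^sub>0\<bar>\<rceil>"]) linarith
      ultimately have "\<forall>\<^sub>F r in sequentially. E r < e / 4 \<and> \<bar>x\<^sub>0\<bar> \<le> real r" by (rule eventually_conj)
      then obtain r where r: "E r < e / 4" "\<bar>x\<^sub>0\<bar> \<le> real r" using eventually_happens by fastforce
      have "compact (\<phi> ` {- real r..real r})"
        by (rule compact_continuous_image[OF continuous_on_subset[OF cont]]) auto
      then have "bounded (\<phi> ` {- real r..real r})" by (rule compact_imp_bounded)
      then obtain b where "\<forall>y\<in>\<phi> ` {- real r..real r}. norm y \<le> b"
        unfolding bounded_iff by (elim exE)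
      then have b: "\<bar>\<phi> x\<bar> \<le> b" if "\<bar>x\<bar> \<le> real r" for x using that by (auto simp: abs_le_iff)
      have b0: "0 < b" using b[of 0] \<phi>_pos[of 0] by simp
      have "\<forall>\<^sub>F n in sequentially. (\<Sum>i = 1..n. tail_weight (real r) (X i \<omega>)) / n < e / 2"
        using elim(2)[rule_format, of r] r e unfolding E_def by (intro order_tendstoD(2)) auto
      moreover have "\<forall>\<^sub>F n in sequentially. \<forall>x. \<bar>empirical_cdf X n \<omega> x - ?F x\<bar> \<le> e / b"
        using elim(1) e b0 by simp
      ultimately show "\<forall>\<^sub>F n in sequentially. weighted_norm \<phi> (\<lambda>x. empirical_cdf X n \<omega> x - ?F x) \<le> ennreal e"
        using eventually_ge_at_top[of 1]
      proof eventually_elim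
        case (elim n)
        show ?case
          unfolding weighted_norm_def
        proof (rule SUP_least, rule ennreal_leI)
          fix x
          show "\<bar>empirical_cdf X n \<omega> x - ?F x\<bar> * \<phi> x \<le> e"
          proof (cases "\<bar>x\<bar> \<le> real r")
            case True
            have "\<bar>empirical_cdf X n \<omega> x - ?F x\<bar> * \<phi> x \<le> (e / b) * b"
              using elim(2) b[OF True] \<phi>_pos[of x] e b0 by (intro mult_mono) auto
            then show ?thesis using b0 by simp
          next
            case False
            then have "\<bar>empirical_cdf X n \<omega> x - ?F x\<bar> * \<phi> x
                \<le> (\<Sum>i = 1..n. tail_weight (real r) (X i \<omega>)) / n + E r"
              unfolding E_def by (intro weighted_tail_bound[OF anti mono r(2) _ elim(3)]) simp
            then show ?thesis using elim(1) r(1) e by linarith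
          qed
        qed
      qed
    qed
  qed
qed

end

theorem theorem2p3:
  fixes M :: "'a measure"
    and X :: "nat \<Rightarrow> 'a \<Rightarrow> real"
    and F G \<phi> :: "real \<Rightarrow> real"
  assumes "prob_space M"
    and "\<And>i. i \<ge> 1 \<Longrightarrow> X i \<in> borel_measurable M"
    and "\<And>i. i \<ge> 1 \<Longrightarrow> distr M borel (X i) = distr M borel (X 1)"
    and "F = cdf (distr M borel (X 1))"
    and "weight_function \<phi>"
    and "(\<integral>\<^sup>+ x. ennreal (\<phi> x) \<partial>interval_measure F) < \<infinity>"
    and "alpha_mixing M X"
    and "G = cdf (distr M borel (\<lambda>\<omega>. \<phi> (X 1 \<omega>)))"
    and "(\<integral>\<^sup>+ s\<in>{0..1}.
            (ennreal_log1p (right_inverse (cadlag_ext (alpha_coeff M X)) (s / 2))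
              * right_inverse (\<lambda>x. 1 - G x) s) \<partial>lborel) < \<infinity>"
  shows "AE \<omega> in M.
    (\<lambda>n. weighted_norm \<phi> (\<lambda>x. empirical_cdf X n \<omega> x - F x)) \<longlonglongrightarrow> 0"
proof -
  obtain \<epsilon> where \<epsilon>: "0 < \<epsilon>" "\<And>x. \<epsilon> \<le> \<phi> x" and cont: "continuous_on UNIV \<phi>"
    using assms(5) unfolding weight_function_def by blast
  have \<phi>_meas: "\<phi> \<in> borel_measurable borel" by (rule borel_measurable_continuous_onI[OF cont])
  interpret prob_space M by (rule assms(1))
  have X1: "X 1 \<in> borel_measurable M" using assms(2) by simp
  interpret D: cdf_distribution "distr M borel (X 1)"
    unfolding cdf_distribution_def by (rule real_distribution_distr) (use X1 in simp)
  have law: "interval_measure F = distr M borel (X 1)"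
  proof (rule cdf_unique)
    note F = D.cdf_nondecreasing D.cdf_is_right_cont D.cdf_lim_at_bot
    show "real_distribution (interval_measure F)"
      unfolding assms(4) by (rule real_distribution_interval_measure[OF F D.cdf_lim_at_top_prob])
    show "cdf (interval_measure F) = cdf (distr M borel (X 1))"
      unfolding assms(4) by (rule cdf_interval_measure[OF F])
  qed unfold_locales
  have mean: "(\<integral>\<^sup>+\<omega>. ennreal (\<phi> (X 1 \<omega>)) \<partial>M) < \<infinity>"
    using assms(6) X1 \<phi>_meas unfolding law by (simp add: nn_integral_distr)
  interpret weighted_mixing M X \<phi> \<epsilon>
    by unfold_locales
      (fact assms(2) assms(3) assms(7) assms(9)[unfolded assms(8)] \<phi>_meas \<epsilon> mean)+
  show ?thesis
    unfolding assms(4) by (rule weighted_glivenko_cantelli[OF assms(5)])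
qed

end
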